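(* Let $M=\begin{pmatrix} a&b\\ c&d\end{pmatrix}$ be a color matrix for an integrally colored $2$-tangle $T$, and put $f(T):=\frac{b-a}{b-d}$. Then: 1. $M$ satisfies the diagonal sum rule: $a+d=b+c$. 2. If $T$ is rational, then $f(T)$ is a topological invariant of the tangle $T$ (it does not depend on the choice of the non-constant integral coloring, nor on the diagram of $T$ within its isotopy class). 3. $f(T+S)=f(T)+f(S)$ whenever an integral coloring of a tangle $T+S$ is given, where the colorings of $T$ and $S$ are the restrictions of the coloring of $T+S$ to these subtangles. 4. $f(-\frac1T)=-\frac{1}{f(T)}$ for any integrally colored $2$-tangle $T$ satisfying the diagonal sum rule (with $-\frac1T$ carrying the coloring rotated along with $T$). 5. $f(-T)=-f(T)$ for any rational tangle $T$. 6. $f(\frac1T)=\frac{1}{f(T)}$ for any rational tangle $T$. 7. $f(T)=F(T)$ for any rational tangle $T$, where $F(T)$ is the arithmetical fraction of $T$.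
   Context: A $2$-tangle is a proper embedding of two unoriented arcs and finitely many circles in a $3$-ball, with the four arc endpoints on the boundary, represented by a diagram in a disc with endpoints at NW, NE, SW, SE; isotopy is relative to the boundary. Elementary tangles: $[0]$ consists of two uncrossed arcs joining NW–NE and SW–SE; $[\infty]$ of two uncrossed arcs joining NW–SW and NE–SE; $[+1]$ is the single-crossing tangle whose overcrossing strand joins NW to SE, and $[-1]$ is the opposite crossing. $T+S$: place $S$ to the right of $T$ and join NE, SE of $T$ to NW, SW of $S$. $T*S$: place $S$ below $T$ and join SW, SE of $T$ to NW, NE of $S$. The mirror image $-T$ is $T$ with all crossings switched; $T^r$ is $T$ rotated counterclockwise by $90^\circ$ in the plane, also denoted $-\frac1T$; for a rational tangle, $\frac1T:=-T^r$ (the mirror image of the rotation). A rational tangle is one having, up to isotopy, a diagram in twist form, i.e. obtained from $[0]$ or $[\infty]$ by finitely many operations $T\mapsto T+[\pm1],\ [\pm1]+T,\ T*[\pm1],\ [\pm1]*T$. Its arithmetical fraction is computed from a twist form diagram by $F([0])=0$, $F([\infty])=\infty=\frac10$, $F(T+[\pm1])=F([\pm1]+T)=F(T)\pm1$, $F(T*[\pm1])=F([\pm1]*T)=\frac{1}{\pm1+\frac1{F(T)}}$. An integral coloring of a tangle diagram assigns an integer to each arc of the diagram (arcs running from undercrossing to undercrossing or to an endpoint) so that at each crossing, if the two undercrossing arcs are colored $\alpha,\gamma$ and the overcrossing arc is colored $\beta$, then $\alpha+\gamma=2\beta$. Every rational tangle has non-constant integral colorings. Colorings are transported uniquely under Reidemeister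 moves without changing the colors at the endpoints. The color matrix of a colored tangle is $\begin{pmatrix} NW&NE\\ SW&SE\end{pmatrix}$, the colors at the four endpoints. For a colored non-rational tangle, $f(T)$ is defined by the same formula but may depend on the coloring. Values of $f$ lie in $\mathbb{Q}\cup\{\infty\}$ with $\frac{x}{0}=\infty$ for $x\ne0$, $\frac1\infty=0$, $-\infty=\infty$, $\infty+x=\infty$ and $\infty+\infty=\infty$; the expression $\frac00$ is undefined, and the identities are asserted for colorings for which all fractions involved are defined (for rational $T$ these are exactly the non-constant colorings). *)

theory Defs
  imports Complex_Main "HOL-Library.Multiset" "HOL-Combinatorics.Orbits"
begin

section \<open>Tangle diagrams\<close>

text \<open>
  A diagram is given by a planar diagram code.  Its edges are named by natural numbers.
  \<open>Crossing i j k l\<close> lists the four edges at a crossing in counterclockwise order; \<open>i\<close> and \<open>k\<close>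
  belong to the understrand, \<open>j\<close> and \<open>l\<close> to the overstrand.  \<open>Joint a b\<close> is an auxiliary bivalent
  vertex on a strand, at which the edges \<open>a\<close> and \<open>b\<close> are glued to each other; joints express the
  gluing of tangles, and \<open>Joint a a\<close> is a circle without crossings.  The last four components of a
  diagram are the edges ending in the four endpoints.
\<close>

datatype vertex = Crossing nat nat nat nat | Joint nat nat

datatype diagram = Diagram (vertices: "vertex list") (NW: nat) (NE: nat) (SW: nat) (SE: nat)

fun edges_at :: "vertex \<Rightarrow> nat list" where
  "edges_at (Crossing i j k l) = [i, j, k, l]"
| "edges_at (Joint a b) = [a, b]"

text \<open>
  The boundary circle of the disc is collapsed to one further vertex.  Seen from that vertex the
  endpoints follow each other counterclockwise in the order NW, NE, SE, SW.
\<close>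

definition rotation_system :: "diagram \<Rightarrow> nat list list" where
  "rotation_system D = [NW D, NE D, SE D, SW D] # map edges_at (vertices D)"

definition edges :: "diagram \<Rightarrow> nat set" where
  "edges D = set (concat (rotation_system D))"

text \<open>
  Every edge has exactly two ends, so the strands are two arcs and finitely many circles.
\<close>

definition edges_have_two_ends :: "diagram \<Rightarrow> bool" where
  "edges_have_two_ends D \<longleftrightarrow> (\<forall>x\<in>edges D. count_list (concat (rotation_system D)) x = 2)"

text \<open>
  The half-edge \<open>(v, i)\<close> is the \<open>i\<close>-th edge end at the \<open>v\<close>-th vertex.  The faces of the underlying
  combinatorial map are the orbits of: pass to the other end of the edge, then turn to the next
  half-edge at the vertex reached.
\<close>

definition half_edges :: "diagram \<Rightarrow> (nat \<times> nat) set" where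
  "half_edges D = {(v, i). v < length (rotation_system D) \<and> i < length (rotation_system D ! v)}"

definition other_end :: "diagram \<Rightarrow> nat \<times> nat \<Rightarrow> nat \<times> nat" where
  "other_end D h = (THE h'. h' \<in> half_edges D \<and> h' \<noteq> h \<and>
      rotation_system D ! fst h' ! snd h' = rotation_system D ! fst h ! snd h)"

definition turn :: "diagram \<Rightarrow> nat \<times> nat \<Rightarrow> nat \<times> nat" where
  "turn D h = (fst h, Suc (snd h) mod length (rotation_system D ! fst h))"

definition faces :: "diagram \<Rightarrow> (nat \<times> nat) set set" where
  "faces D = orbit (turn D \<circ> other_end D) ` half_edges D"

definition adjacency :: "diagram \<Rightarrow> (nat \<times> nat) set" where
  "adjacency D = {(u, v). u < length (rotation_system D) \<and> v < length (rotation_system D) \<and>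
      set (rotation_system D ! u) \<inter> set (rotation_system D ! v) \<noteq> {}}"

definition components :: "diagram \<Rightarrow> nat set set" where
  "components D = {..<length (rotation_system D)} // (adjacency D)\<^sup>*"

text \<open>
  Euler's formula.  Faces are counted separately for every connected component, so the Euler
  characteristics add up to twice the number of components iff every component has genus 0.
\<close>

definition planar :: "diagram \<Rightarrow> bool" where
  "planar D \<longleftrightarrow>
     length (rotation_system D) + card (faces D) = card (edges D) + 2 * card (components D)"

definition tangle_diagram :: "diagram \<Rightarrow> bool" where
  "tangle_diagram D \<longleftrightarrow> edges_have_two_ends D \<and> planar D"


section \<open>Isotopy\<close>

fun rename_vertex :: "(nat \<Rightarrow> nat) \<Rightarrow> vertex \<Rightarrow> vertex" where
  "rename_vertex r (Crossing i j k l) = Crossing (r i) (r j) (r k) (r l)"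
| "rename_vertex r (Joint a b) = Joint (r a) (r b)"

fun rename :: "(nat \<Rightarrow> nat) \<Rightarrow> diagram \<Rightarrow> diagram" where
  "rename r (Diagram vs nw ne sw se) =
     Diagram (map (rename_vertex r) vs) (r nw) (r ne) (r sw) (r se)"

text \<open>
  Replacements inside a small disc.  In the third Reidemeister move the strand \<open>t\<close> runs over \<open>m\<close>
  and \<open>b\<close>, and \<open>m\<close> runs over \<open>b\<close>; the strand \<open>t\<close> is moved across the crossing of \<open>m\<close> and \<open>b\<close>.  The
  two versions differ in the cyclic order of the three strands around the triangle.
\<close>

inductive local_move :: "vertex list \<Rightarrow> vertex list \<Rightarrow> bool" where
  crossing_symmetry: "local_move [Crossing i j k l] [Crossing k l i j]"
| joint_symmetry: "local_move [Joint a b] [Joint b a]"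
| R1_under_over: "local_move [Joint a b] [Crossing c c a b]"
| R1_over_under: "local_move [Joint a b] [Crossing a c c b]"
| R2: "local_move [Joint a b, Joint c d] [Crossing c e f a, Crossing d b f e]"
| R3_tmb: "local_move
    [Crossing m1 t2 m2 t1, Crossing b1 t3 b2 t2, Crossing b2 m3 b3 m2]
    [Crossing b2 t2 b3 t1, Crossing m2 t3 m3 t2, Crossing b1 m2 b2 m1]"
| R3_tbm: "local_move
    [Crossing b1 t2 b2 t1, Crossing m1 t3 m2 t2, Crossing b2 m2 b3 m3]
    [Crossing m2 t2 m3 t1, Crossing b2 t3 b3 t2, Crossing b1 m1 b2 m2]"

text \<open>
  The first three rules only change the code, not the picture.
\<close>

inductive move :: "diagram \<Rightarrow> diagram \<Rightarrow> bool" where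
  renaming: "inj_on r (edges D) \<Longrightarrow> move D (rename r D)"
| reordering: "mset vs = mset vs' \<Longrightarrow> move (Diagram vs nw ne sw se) (Diagram vs' nw ne sw se)"
| joint_removal: "a \<noteq> b \<Longrightarrow>
    move (Diagram (Joint a b # vs) nw ne sw se) (rename (id(b := a)) (Diagram vs nw ne sw se))"
| local: "local_move us us' \<Longrightarrow>
    move (Diagram (us @ vs) nw ne sw se) (Diagram (us' @ vs) nw ne sw se)"

text \<open>
  All intermediate diagrams have to be planar tangle diagrams.  This makes the local replacements
  geometric: the edges created by a first or second Reidemeister move are fresh because every edge
  has exactly two ends, and in a planar diagram the monogon, bigon or triangle of the move is a face.
  The endpoints never move, so this is isotopy relative to the boundary.
\<close>

definition isotopic :: "diagram \<Rightarrow> diagram \<Rightarrow> bool" where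
  "isotopic = equivclp (\<lambda>D D'. tangle_diagram D \<and> tangle_diagram D' \<and> move D D')"


section \<open>Operations on tangles\<close>

definition left_edge :: "nat \<Rightarrow> nat" where
  "left_edge x = 2 * x"

definition right_edge :: "nat \<Rightarrow> nat" where
  "right_edge x = 2 * x + 1"

definition tangle_sum :: "diagram \<Rightarrow> diagram \<Rightarrow> diagram" where
  "tangle_sum T S = (let T' = rename left_edge T; S' = rename right_edge S in
     Diagram (Joint (NE T') (NW S') # Joint (SE T') (SW S') # vertices T' @ vertices S')
       (NW T') (NE S') (SW T') (SE S'))"

definition tangle_prod :: "diagram \<Rightarrow> diagram \<Rightarrow> diagram" where
  "tangle_prod T S = (let T' = rename left_edge T; S' = rename right_edge S in
     Diagram (Joint (SW T') (NW S') # Joint (SE T') (NE S') # vertices T' @ vertices S')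
       (NW T') (NE T') (SW S') (SE S'))"

fun switch_vertex :: "vertex \<Rightarrow> vertex" where
  "switch_vertex (Crossing i j k l) = Crossing j k l i"
| "switch_vertex (Joint a b) = Joint a b"

fun mirror :: "diagram \<Rightarrow> diagram" where
  "mirror (Diagram vs nw ne sw se) = Diagram (map switch_vertex vs) nw ne sw se"

text \<open>
  Counterclockwise rotation by 90 degrees moves NE to NW, SE to NE, NW to SW and SW to SE.  The
  edges keep their names, so a coloring of \<open>T\<close> is at the same time the rotated coloring of
  \<open>rotate_ccw T\<close>.
\<close>

fun rotate_ccw :: "diagram \<Rightarrow> diagram" where
  "rotate_ccw (Diagram vs nw ne sw se) = Diagram vs ne se nw sw"


section \<open>Rational tangles and the arithmetical fraction\<close>

datatype qinf = Fin rat | Infty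

instantiation qinf :: "{plus, uminus}"
begin

fun plus_qinf :: "qinf \<Rightarrow> qinf \<Rightarrow> qinf" where
  "plus_qinf (Fin x) (Fin y) = Fin (x + y)"
| "plus_qinf _ _ = Infty"

fun uminus_qinf :: "qinf \<Rightarrow> qinf" where
  "uminus_qinf (Fin x) = Fin (- x)"
| "uminus_qinf Infty = Infty"

instance ..

end

fun recip :: "qinf \<Rightarrow> qinf" where
  "recip (Fin x) = (if x = 0 then Infty else Fin (1 / x))"
| "recip Infty = Fin 0"

datatype sign = Pos | Neg

fun sign_value :: "sign \<Rightarrow> qinf" where
  "sign_value Pos = Fin 1"
| "sign_value Neg = Fin (- 1)"

text \<open>
  Edge names in the elementary one-crossing tangles: 0 ends in NW, 1 in NE, 2 in SW, 3 in SE.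
\<close>

definition zero_tangle :: diagram where
  "zero_tangle = Diagram [] 0 0 1 1"

definition infinity_tangle :: diagram where
  "infinity_tangle = Diagram [] 0 1 0 1"

fun unit_tangle :: "sign \<Rightarrow> diagram" where
  "unit_tangle Pos = Diagram [Crossing 2 3 1 0] 0 1 2 3"
| "unit_tangle Neg = Diagram [Crossing 0 2 3 1] 0 1 2 3"

datatype twist_form =
    Zero
  | Infinity
  | AddRight twist_form sign
  | AddLeft sign twist_form
  | MulBelow twist_form sign
  | MulAbove sign twist_form

fun twist_diagram :: "twist_form \<Rightarrow> diagram" where
  "twist_diagram Zero = zero_tangle"
| "twist_diagram Infinity = infinity_tangle"
| "twist_diagram (AddRight w s) = tangle_sum (twist_diagram w) (unit_tangle s)"
| "twist_diagram (AddLeft s w) = tangle_sum (unit_tangle s) (twist_diagram w)"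
| "twist_diagram (MulBelow w s) = tangle_prod (twist_diagram w) (unit_tangle s)"
| "twist_diagram (MulAbove s w) = tangle_prod (unit_tangle s) (twist_diagram w)"

fun arith_fraction :: "twist_form \<Rightarrow> qinf" where
  "arith_fraction Zero = Fin 0"
| "arith_fraction Infinity = Infty"
| "arith_fraction (AddRight w s) = arith_fraction w + sign_value s"
| "arith_fraction (AddLeft s w) = arith_fraction w + sign_value s"
| "arith_fraction (MulBelow w s) = recip (sign_value s + recip (arith_fraction w))"
| "arith_fraction (MulAbove s w) = recip (sign_value s + recip (arith_fraction w))"

definition rational :: "diagram \<Rightarrow> bool" where
  "rational T \<longleftrightarrow> tangle_diagram T \<and> (\<exists>w. isotopic T (twist_diagram w))"


section \<open>Integral colorings\<close>

text \<open>
  An arc of the diagram is a maximal chain of edges continued through joints and through crossings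
  on the overstrand; a coloring of the arcs is a coloring of the edges that does not change there.
\<close>

fun colored_at :: "(nat \<Rightarrow> int) \<Rightarrow> vertex \<Rightarrow> bool" where
  "colored_at \<kappa> (Crossing i j k l) \<longleftrightarrow> \<kappa> j = \<kappa> l \<and> \<kappa> i + \<kappa> k = 2 * \<kappa> j"
| "colored_at \<kappa> (Joint a b) \<longleftrightarrow> \<kappa> a = \<kappa> b"

definition coloring :: "diagram \<Rightarrow> (nat \<Rightarrow> int) \<Rightarrow> bool" where
  "coloring T \<kappa> \<longleftrightarrow> (\<forall>v\<in>set (vertices T). colored_at \<kappa> v)"

definition nonconstant :: "diagram \<Rightarrow> (nat \<Rightarrow> int) \<Rightarrow> bool" where
  "nonconstant T \<kappa> \<longleftrightarrow> (\<exists>x\<in>edges T. \<exists>y\<in>edges T. \<kappa> x \<noteq> \<kappa> y)"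

text \<open>
  The tuple \<open>(a, b, c, d)\<close> stands for the matrix with rows \<open>a b\<close> (NW, NE) and \<open>c d\<close> (SW, SE).
\<close>

type_synonym color_matrix = "int \<times> int \<times> int \<times> int"

definition color_matrix :: "diagram \<Rightarrow> (nat \<Rightarrow> int) \<Rightarrow> color_matrix" where
  "color_matrix T \<kappa> = (\<kappa> (NW T), \<kappa> (NE T), \<kappa> (SW T), \<kappa> (SE T))"

fun diagonal_sum_rule :: "color_matrix \<Rightarrow> bool" where
  "diagonal_sum_rule (a, b, c, d) \<longleftrightarrow> a + d = b + c"

text \<open>
  The fraction \<open>(b - a) / (b - d)\<close>.  The value given here to \<open>0 / 0\<close> is meaningless and is
  excluded by \<open>fraction_defined\<close> wherever the fraction is used.
\<close>

fun matrix_fraction :: "color_matrix \<Rightarrow> qinf" where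
  "matrix_fraction (a, b, c, d) =
     (if b - d = 0 then Infty else Fin (of_int (b - a) / of_int (b - d)))"

fun matrix_fraction_defined :: "color_matrix \<Rightarrow> bool" where
  "matrix_fraction_defined (a, b, c, d) \<longleftrightarrow> \<not> (b - a = 0 \<and> b - d = 0)"

definition fraction :: "diagram \<Rightarrow> (nat \<Rightarrow> int) \<Rightarrow> qinf" where
  "fraction T \<kappa> = matrix_fraction (color_matrix T \<kappa>)"

definition fraction_defined :: "diagram \<Rightarrow> (nat \<Rightarrow> int) \<Rightarrow> bool" where
  "fraction_defined T \<kappa> \<longleftrightarrow> matrix_fraction_defined (color_matrix T \<kappa>)"

text \<open>
  \<open>has_fraction T q\<close>: the diagram \<open>T\<close> has a fraction independent of the coloring, namely \<open>q\<close>.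
\<close>

definition has_fraction :: "diagram \<Rightarrow> qinf \<Rightarrow> bool" where
  "has_fraction T q \<longleftrightarrow>
     (\<exists>\<kappa>. coloring T \<kappa> \<and> nonconstant T \<kappa>) \<and>
     (\<forall>\<kappa>. coloring T \<kappa> \<and> nonconstant T \<kappa> \<longrightarrow> fraction_defined T \<kappa> \<and> fraction T \<kappa> = q)"

end

theory Submission
  imports Defs
begin

text \<open>
  The diagonal sum rule says that the alternating sum of the colors around the boundary vertex
  vanishes, as it does around every crossing and joint.  Since all degrees are even and the diagram
  has genus 0, its faces admit a checkerboard coloring, so the alternating sums at all vertices can
  be given signs such that every edge occurs in their total twice with opposite signs.  The
  checkerboard coloring exists because in genus 0 every mod 2 cycle of edges is the boundary of a
  union of faces, which follows from Euler's formula by counting.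

  The local moves, and their mirror images, transport colorings without changing the four end
  colors or constancy, so it remains to compute with twist forms.  There a coloring extends over an
  added crossing in exactly one way; with \<open>x = b - a\<close> and \<open>y = b - d\<close>, adding a crossing replaces
  \<open>x\<close> by \<open>x \<plusminus> y\<close>, multiplying by one replaces \<open>y\<close> by \<open>y \<plusminus> x\<close>.
\<close>

section \<open>Checkerboard colorings of planar diagrams\<close>

text \<open>Genus 0 is essential for the diagonal sum rule: two arcs joining NW to SE and NE to SW
  without any crossing form a code of genus 1 that violates it. A general tangle has no twist form
  to induct over, so the rule needs a global argument. The counting is homology over the field with
  two elements: sets of faces, edges and vertices are chains, symmetric difference is addition, and
  a cardinality stands for 2 to the power of a dimension. With V vertices, E edges, F faces and C
  components, boundaries have dimension at least F - C and cycles at most E - V + C; Euler's formula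
  makes these numbers equal.

  The fraction is x / y in the coordinates of the overview. A quarter turn sends (x, y) to (-y, x),
  provided that the diagonal sum rule holds, so the rule has to accompany the fraction through all
  constructions.\<close>

text \<open>Rank-nullity over the field with two elements: a map additive for symmetric difference
  has all its nonempty fibres in bijection with its kernel.\<close>

lemma card_additive_image:
  fixes f :: "'a set \<Rightarrow> 'b set"
  assumes "finite A" and "A \<noteq> {}"
    and closed: "\<And>X Y. X \<in> A \<Longrightarrow> Y \<in> A \<Longrightarrow> sym_diff X Y \<in> A"
    and additive: "\<And>X Y. X \<in> A \<Longrightarrow> Y \<in> A \<Longrightarrow> f (sym_diff X Y) = sym_diff (f X) (f Y)"
  shows "card A = card (f ` A) * card {X \<in> A. f X = {}}"
proof -
  have fiber: "card {X \<in> A. f X = y} = card {X \<in> A. f X = {}}" if y: "y \<in> f ` A" for y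
  proof -
    obtain X0 where X0: "X0 \<in> A" "y = f X0" using y by blast
    have inv: "sym_diff X0 (sym_diff X0 X) = X" for X by blast
    \<comment> \<open>Translation by a member \<open>X0\<close> of the fibre is its own inverse and
      exchanges fibre and kernel.\<close>
    have "bij_betw (sym_diff X0) {X \<in> A. f X = y} {X \<in> A. f X = {}}"
    proof (rule bij_betw_byWitness[where f' = "sym_diff X0"])
      show "sym_diff X0 ` {X \<in> A. f X = y} \<subseteq> {X \<in> A. f X = {}}"
        using X0 closed additive by auto
      show "sym_diff X0 ` {X \<in> A. f X = {}} \<subseteq> {X \<in> A. f X = y}"
        using X0 closed additive by auto
    qed (use inv in blast)+
    then show ?thesis by (rule bij_betw_same_card)
  qed
  have "card A = (\<Sum>y\<in>f ` A. card {X \<in> A. f X = y})"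
    using sum.image_gen[OF \<open>finite A\<close>, of "\<lambda>_. 1::nat" f] by simp
  also have "\<dots> = card (f ` A) * card {X \<in> A. f X = {}}"
    using fiber by simp
  finally show ?thesis .
qed

lemma odd_card_sym_diff:
  assumes "finite A" "finite B"
  shows "odd (card (sym_diff A B)) \<longleftrightarrow> odd (card A) \<noteq> odd (card B)"
proof -
  have "card (sym_diff A B) = card (A - B) + card (B - A)"
    using assms by (subst card_Un_disjoint) auto
  moreover have "card A = card (A - B) + card (A \<inter> B)"
    using assms by (subst card_Un_disjoint[symmetric]) (auto simp: Un_Diff_Int)
  moreover have "card B = card (B - A) + card (A \<inter> B)"
    using assms by (subst card_Un_disjoint[symmetric]) (auto intro: arg_cong[where f = card])
  ultimately show ?thesis by presburger
qed

section \<open>Mod 2 chains on an abstract combinatorial map\<close>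

locale combinatorial_map =
  fixes H :: "'h set" and nxt opp :: "'h \<Rightarrow> 'h" and vert :: "'h \<Rightarrow> 'v" and lab :: "'h \<Rightarrow> 'e"
  assumes finite_H: "finite H"
    and bij_nxt: "bij_betw nxt H H"
    and opp_in: "h \<in> H \<Longrightarrow> opp h \<in> H"
    and opp_opp: "h \<in> H \<Longrightarrow> opp (opp h) = h"
    and opp_neq: "h \<in> H \<Longrightarrow> opp h \<noteq> h"
    and vert_nxt: "h \<in> H \<Longrightarrow> vert (nxt h) = vert h"
    and nxt_trans: "h \<in> H \<Longrightarrow> h' \<in> H \<Longrightarrow> vert h = vert h' \<Longrightarrow> \<exists>n. h' = (nxt ^^ n) h"
    and lab_eq: "h \<in> H \<Longrightarrow> h' \<in> H \<Longrightarrow> lab h = lab h' \<longleftrightarrow> h' = h \<or> h' = opp h"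
begin

definition adj :: "('v \<times> 'v) set" where
  "adj = (\<lambda>h. (vert h, vert (opp h))) ` H"

abbreviation "comps \<equiv> (vert ` H) // adj\<^sup>*"

abbreviation "face_orbits \<equiv> orbit (nxt \<circ> opp) ` H"

text \<open>The 2-chains. The face permutation is \<open>nxt\<close> after \<open>opp\<close>, and
  invariance under it makes a set of half-edges a union of faces.\<close>

definition face_unions :: "'h set set" where
  "face_unions = {S. S \<subseteq> H \<and> (\<forall>h\<in>H. nxt (opp h) \<in> S \<longleftrightarrow> h \<in> S)}"

text \<open>The boundary of a 2-chain: an edge belongs to it iff exactly one of its two sides is in
  \<open>S\<close>. An edge with the same face on both sides never does.\<close>

definition face_bd :: "'h set \<Rightarrow> 'e set" where
  "face_bd S = {lab h | h. h \<in> H \<and> h \<in> S \<and> opp h \<notin> S}"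

text \<open>The boundary of a 1-chain. Half-edges are counted, not edges, so that a loop contributes
  twice to its vertex and cancels.\<close>

definition edge_bd :: "'e set \<Rightarrow> 'v set" where
  "edge_bd Y = {v. odd (card {h \<in> H. vert h = v \<and> lab h \<in> Y})}"

lemma nxt_in: "h \<in> H \<Longrightarrow> nxt h \<in> H"
  using bij_nxt by (auto simp: bij_betw_def)

lemma bij_face: "bij_betw (nxt \<circ> opp) H H"
proof (rule bij_betw_trans[OF _ bij_nxt])
  show "bij_betw opp H H"
    by (rule bij_betw_byWitness[where f' = opp]) (auto simp: opp_in opp_opp)
qed

lemma finite_comps: "finite comps"
  unfolding quotient_def using finite_H by auto

text \<open>Faces are disjoint and nonempty, so different sets of faces have different
  unions.\<close>

lemma card_face_orbits_le: "2 ^ card face_orbits \<le> card face_unions"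
proof -
  \<comment> \<open>The library's \<open>permutes\<close> demands the identity outside
    \<open>H\<close>, hence this extension of the face map.\<close>
  define f where "f h = (if h \<in> H then (nxt \<circ> opp) h else h)" for h
  have bij: "bij_betw f H H"
    using bij_face by (rule bij_betw_cong[THEN iffD1, rotated]) (simp add: f_def)
  have perm: "f permutes H"
    by (rule bij_imp_permutes[OF bij]) (simp add: f_def)
  have orb: "orbit (nxt \<circ> opp) h = orbit f h" if "h \<in> H" for h
    using that by (rule orbit_cong0) (auto simp: f_def opp_in nxt_in)
  have orb_eq: "orbit f y = orbit f x" if "y \<in> orbit f x" for x y
    using orbit_cyclic_eq3[OF cyclic_on_orbit[OF perm finite_H]] that by blast
  have sub: "orbit f x \<subseteq> H" if "x \<in> H" for x
    using permutes_orbit_subset[OF perm that] .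
  have inj: "inj_on Union (Pow face_orbits)"
  proof -
    have le: "P \<subseteq> Q" if PQ: "P \<subseteq> face_orbits" "Q \<subseteq> face_orbits" "\<Union>P = \<Union>Q" for P Q
    proof
      fix c assume c: "c \<in> P"
      then obtain x where x: "x \<in> H" "c = orbit f x" using PQ orb by auto
      obtain y where y: "y \<in> c" using x orbit.base by fast
      then obtain c' where c': "c' \<in> Q" "y \<in> c'" using PQ c by blast
      then obtain x' where x': "x' \<in> H" "c' = orbit f x'" using PQ orb by auto
      have "c = c'" using x x' y c' orb_eq by metis
      then show "c \<in> Q" using c' by simp
    qed
    show ?thesis by (rule inj_onI) (metis PowD le order_antisym)
  qed
  have into: "Union ` Pow face_orbits \<subseteq> face_unions"
  proof
    fix S assume "S \<in> Union ` Pow face_orbits"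
    then obtain P where P: "P \<subseteq> face_orbits" "S = \<Union>P" by blast
    have S: "S \<subseteq> H" using P orb sub by fastforce
    have fwd: "f h \<in> S" if h: "h \<in> S" for h
    proof -
      obtain c where c: "c \<in> P" "h \<in> c" using h P by blast
      then obtain x where "x \<in> H" "c = orbit f x" using P orb by auto
      then have "f h \<in> c" using c by (auto intro: orbit.step)
      then show ?thesis using c P by blast
    qed
    have injS: "inj_on f S"
      using bij S by (auto simp: bij_betw_def dest: inj_on_subset)
    \<comment> \<open>An injective map of a finite set into itself is onto; this supplies the
      converse of \<open>fwd\<close>.\<close>
    have fS: "f ` S = S"
      by (rule card_subset_eq[OF finite_subset[OF S finite_H]])
        (use fwd injS in \<open>auto intro!: card_image\<close>)
    have "f h \<in> S \<longleftrightarrow> h \<in> S" if "h \<in> H" for h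
      using that fS bij S by (metis bij_betw_def inj_on_image_mem_iff)
    then show "S \<in> face_unions"
      using S by (auto simp: face_unions_def f_def)
  qed
  have fin: "finite face_unions"
    by (rule finite_subset[of _ "Pow H"]) (auto simp: face_unions_def finite_H)
  have "card (Pow face_orbits) \<le> card face_unions"
    by (rule card_inj_on_le[OF inj into fin])
  then show ?thesis by (simp add: card_Pow finite_H)
qed

lemma face_bd_mem:
  assumes "S \<in> face_unions" "h \<in> H"
  shows "lab h \<in> face_bd S \<longleftrightarrow> (h \<in> S) \<noteq> (opp h \<in> S)"
  unfolding face_bd_def using assms lab_eq opp_in opp_opp by (auto; metis)

lemma face_bd_sub: "face_bd S \<subseteq> lab ` H"
  by (auto simp: face_bd_def)

lemma face_bd_additive:
  assumes "S \<in> face_unions" "S' \<in> face_unions"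
  shows "sym_diff S S' \<in> face_unions"
    and "face_bd (sym_diff S S') = sym_diff (face_bd S) (face_bd S')"
proof -
  show *: "sym_diff S S' \<in> face_unions"
    using assms by (auto simp: face_unions_def)
  have "e \<in> face_bd (sym_diff S S') \<longleftrightarrow> e \<in> sym_diff (face_bd S) (face_bd S')"
    if "e \<in> lab ` H" for e
    using that by (auto simp: face_bd_mem[OF *] face_bd_mem[OF assms(1)] face_bd_mem[OF assms(2)])
  then show "face_bd (sym_diff S S') = sym_diff (face_bd S) (face_bd S')"
    using face_bd_sub by blast
qed

text \<open>If no edge separates \<open>S\<close> from its complement, then \<open>S\<close> is
  closed under \<open>opp\<close> and, being a union of faces, under \<open>nxt\<close>. So it
  contains the whole component of each of its half-edges and is determined by the set of components
  that it meets.\<close>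

lemma card_face_bd_kernel: "card {S \<in> face_unions. face_bd S = {}} \<le> 2 ^ card comps"
proof -
  let ?K = "{S \<in> face_unions. face_bd S = {}}"
  let ?c = "\<lambda>h. adj\<^sup>* `` {vert h}"
  have opp: "opp h \<in> S \<longleftrightarrow> h \<in> S" if "S \<in> ?K" "h \<in> H" for S h
    using face_bd_mem[of S h] that by auto
  have nx: "nxt h \<in> S \<longleftrightarrow> h \<in> S" if "S \<in> ?K" "h \<in> H" for S h
  proof -
    have "nxt (opp (opp h)) \<in> S \<longleftrightarrow> opp h \<in> S"
      using that opp_in[of h] by (auto simp: face_unions_def)
    then show ?thesis using opp[OF that] that opp_opp by simp
  qed
  have sat: "h' \<in> S" if h: "S \<in> ?K" "h \<in> S" "h' \<in> H" "vert h = vert h'" for S h h'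
  proof -
    have hH: "h \<in> H" using h by (auto simp: face_unions_def)
    obtain n where n: "h' = (nxt ^^ n) h" using nxt_trans hH h by blast
    have "(nxt ^^ n) h \<in> H \<and> (nxt ^^ n) h \<in> S"
      by (induction n) (use hH h nx nxt_in in auto)
    then show ?thesis using n by simp
  qed
  have sat': "h' \<in> S" if "S \<in> ?K" "h \<in> S" "h' \<in> H" "(vert h, vert h') \<in> adj\<^sup>*" for S h h'
  proof -
    \<comment> \<open>The relation \<open>adj\<close> links vertices, so the induction along a path
      has to speak of all half-edges at the vertex reached.\<close>
    have "\<forall>h'\<in>H. vert h' = w \<longrightarrow> h' \<in> S" if "(vert h, w) \<in> adj\<^sup>*" for w
      using that
    proof (induction rule: rtrancl_induct)
      case base
      then show ?case using sat[OF \<open>S \<in> ?K\<close> \<open>h \<in> S\<close>] by simp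
    next
      case (step y z)
      then obtain k where k: "k \<in> H" "y = vert k" "z = vert (opp k)" by (auto simp: adj_def)
      then have "opp k \<in> S" using step opp \<open>S \<in> ?K\<close> by blast
      then show ?case using sat[OF \<open>S \<in> ?K\<close> \<open>opp k \<in> S\<close>] k by simp
    qed
    then show ?thesis using that by blast
  qed
  have inj: "inj_on ((`) ?c) ?K"
  proof -
    have rec: "S = {h \<in> H. ?c h \<in> ?c ` S}" if "S \<in> ?K" for S
    proof -
      have "h \<in> S" if h: "h \<in> H" "k \<in> S" "?c h = ?c k" for h k
      proof -
        have "(vert k, vert h) \<in> adj\<^sup>*" using h by auto
        then show ?thesis using sat' \<open>S \<in> ?K\<close> h by blast
      qed
      moreover have "S \<subseteq> H" using that by (auto simp: face_unions_def)
      ultimately show ?thesis by blast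
    qed
    show ?thesis
    proof (rule inj_onI)
      fix S S' assume S: "S \<in> ?K" "S' \<in> ?K" "?c ` S = ?c ` S'"
      have "S = {h \<in> H. ?c h \<in> ?c ` S}" by (rule rec[OF S(1)])
      also have "\<dots> = S'" unfolding S(3) by (rule rec[OF S(2), symmetric])
      finally show "S = S'" .
    qed
  qed
  have into: "(`) ?c ` ?K \<subseteq> Pow comps"
    by (auto simp: face_unions_def quotient_def)
  have "card ?K \<le> card (Pow comps)"
    by (rule card_inj_on_le[OF inj into]) (simp add: finite_comps)
  then show ?thesis by (simp add: card_Pow finite_comps)
qed

lemma edge_bd_additive: "edge_bd (sym_diff Y Y') = sym_diff (edge_bd Y) (edge_bd Y')"
proof -
  have "{h \<in> H. vert h = v \<and> lab h \<in> sym_diff Y Y'} =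
      sym_diff {h \<in> H. vert h = v \<and> lab h \<in> Y} {h \<in> H. vert h = v \<and> lab h \<in> Y'}" for v
    by blast
  then show ?thesis
    unfolding edge_bd_def by (auto simp: odd_card_sym_diff finite_H)
qed

lemma edge_bd_sub: "edge_bd Y \<subseteq> vert ` H"
proof
  fix v assume "v \<in> edge_bd Y"
  then have "{h \<in> H. vert h = v \<and> lab h \<in> Y} \<noteq> {}"
    unfolding edge_bd_def by (metis (mono_tags, lifting) card.empty even_zero mem_Collect_eq)
  then show "v \<in> vert ` H" by blast
qed

text \<open>The symmetric difference covers loops as well: both sides are then empty.\<close>

lemma edge_bd_single:
  assumes "h \<in> H"
  shows "edge_bd {lab h} = sym_diff {vert h} {vert (opp h)}"
proof -
  have lab: "lab k = lab h \<and> k \<in> H \<longleftrightarrow> k = h \<or> k = opp h" for k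
    using assms lab_eq[of h k] lab_eq[of h "opp h"] opp_in[OF assms] by auto
  have "{k \<in> H. vert k = v \<and> lab k \<in> {lab h}} =
     (if vert h = v then {h} else {}) \<union> (if vert (opp h) = v then {opp h} else {})" for v
    using lab by (auto; metis)
  moreover have "h \<noteq> opp h" using opp_neq[OF assms] by simp
  ultimately show ?thesis
    unfolding edge_bd_def by auto
qed

text \<open>The boundaries of the edges along a path telescope mod 2, leaving its two ends.\<close>

lemma edge_bd_path:
  assumes "(u, v) \<in> adj\<^sup>*"
  shows "\<exists>Y \<subseteq> lab ` H. edge_bd Y = sym_diff {u} {v}"
  using assms
proof (induction rule: rtrancl_induct)
  case base
  show ?case by (rule exI[of _ "{}"]) (simp add: edge_bd_def)
next
  case (step y z)
  then obtain Y where Y: "Y \<subseteq> lab ` H" "edge_bd Y = sym_diff {u} {y}" by blast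
  obtain h where h: "h \<in> H" "y = vert h" "z = vert (opp h)"
    using step by (auto simp: adj_def)
  have "edge_bd (sym_diff Y {lab h}) = sym_diff (sym_diff {u} {y}) (sym_diff {y} {z})"
    using edge_bd_additive Y edge_bd_single h by simp
  also have "\<dots> = sym_diff {u} {z}" by blast
  finally have "edge_bd (sym_diff Y {lab h}) = sym_diff {u} {z}" .
  moreover have "sym_diff Y {lab h} \<subseteq> lab ` H" using Y(1) h(1) by blast
  ultimately show ?case by blast
qed

text \<open>
  With one root per component removed, the edge boundaries reach every set of vertices.
\<close>

lemma card_edge_cycles:
  "card {Y \<in> Pow (lab ` H). edge_bd Y = {}} * 2 ^ card (vert ` H)
     \<le> 2 ^ card (lab ` H) * 2 ^ card comps"
proof -
  let ?V = "vert ` H" and ?E = "lab ` H"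
  define r where "r c = (SOME v. v \<in> c)" for c :: "'v set"
  define R where "R = r ` comps"
  have r: "r c \<in> c" if "c \<in> comps" for c
    using that unfolding r_def quotient_def by (auto intro: someI)
  have conn: "\<exists>w\<in>R. (v, w) \<in> adj\<^sup>*" if "v \<in> ?V" for v
  proof -
    have c: "adj\<^sup>* `` {v} \<in> comps" using that by (rule quotientI)
    then show ?thesis using r[OF c] by (auto simp: R_def)
  qed
  have cR: "card R \<le> card comps" unfolding R_def using finite_comps by (rule card_image_le)
  \<comment> \<open>The boundary map followed by forgetting the roots. It is onto the subsets of the
    remaining vertices, so the size of its kernel is known exactly.\<close>
  define d where "d Y = edge_bd Y - R" for Y
  have d_add: "d (sym_diff Y Y') = sym_diff (d Y) (d Y')" for Y Y'
    unfolding d_def edge_bd_additive by blast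
  have reach: "X \<subseteq> ?V - R \<Longrightarrow> X \<in> d ` Pow ?E" if "finite X" for X
    using that
  proof (induction X rule: finite_induct)
    case empty
    have "d {} = {}" by (simp add: d_def edge_bd_def)
    then show ?case by (metis Pow_bottom imageI)
  next
    case (insert x X)
    then obtain Y where Y: "Y \<subseteq> ?E" "d Y = X" by auto
    obtain w where w: "w \<in> R" "(x, w) \<in> adj\<^sup>*" using conn insert by blast
    obtain Y' where Y': "Y' \<subseteq> ?E" "edge_bd Y' = sym_diff {x} {w}"
      using edge_bd_path[OF w(2)] by metis
    \<comment> \<open>\<open>Y'\<close> is a path from \<open>x\<close> to the root of its
      component; \<open>d\<close> forgets the end at the root and keeps \<open>x\<close>, which is
      no root.\<close>
    have "d Y' = {x}" using Y' w insert by (auto simp: d_def)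
    then have "d (sym_diff Y Y') = insert x X"
      using d_add Y insert by auto
    moreover have "sym_diff Y Y' \<in> Pow ?E" using Y Y' by blast
    ultimately show ?case by (metis imageI)
  qed
  have "d ` Pow ?E = Pow (?V - R)"
  proof
    show "d ` Pow ?E \<subseteq> Pow (?V - R)" using edge_bd_sub by (auto simp: d_def)
    show "Pow (?V - R) \<subseteq> d ` Pow ?E"
      using reach finite_subset[of _ "?V - R"] finite_H by auto
  qed
  then have im: "card (d ` Pow ?E) = 2 ^ card (?V - R)"
    by (simp add: card_Pow finite_H)
  have "card (Pow ?E) = card (d ` Pow ?E) * card {Y \<in> Pow ?E. d Y = {}}"
    by (rule card_additive_image) (use finite_H d_add in auto)
  then have eq: "2 ^ card ?E = 2 ^ card (?V - R) * card {Y \<in> Pow ?E. d Y = {}}"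
    using im by (simp add: card_Pow finite_H)
  \<comment> \<open>Every cycle lies in the kernel of \<open>d\<close>, and at most one vertex per
    component was removed.\<close>
  have "card {Y \<in> Pow ?E. edge_bd Y = {}} \<le> card {Y \<in> Pow ?E. d Y = {}}"
    by (rule card_mono) (auto simp: finite_H d_def)
  moreover have "card ?V \<le> card (?V - R) + card comps"
    using diff_card_le_card_Diff[of R ?V] cR finite_comps by (simp add: R_def)
  then have "(2::nat) ^ card ?V \<le> 2 ^ card (?V - R) * 2 ^ card comps"
    by (simp flip: power_add)
  ultimately have "card {Y \<in> Pow ?E. edge_bd Y = {}} * 2 ^ card ?V
     \<le> card {Y \<in> Pow ?E. d Y = {}} * (2 ^ card (?V - R) * 2 ^ card comps)"
    by (rule mult_le_mono)
  also have "\<dots> = 2 ^ card ?E * 2 ^ card comps" unfolding eq by simp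
  finally show ?thesis .
qed

text \<open>The boundary of a boundary vanishes. Since \<open>nxt h\<close> and \<open>opp h\<close>
  lie in the same face, the edge of \<open>h\<close> is in the boundary iff membership in
  \<open>S\<close> changes between \<open>h\<close> and \<open>nxt h\<close>; going once around a
  vertex, it changes an even number of times.\<close>

lemma edge_bd_face_bd:
  assumes "S \<in> face_unions"
  shows "edge_bd (face_bd S) = {}"
proof -
  have "even (card {h \<in> H. vert h = v \<and> lab h \<in> face_bd S})" for v
  proof -
    let ?Hv = "{h \<in> H. vert h = v}"
    have nS: "nxt h \<in> S \<longleftrightarrow> opp h \<in> S" if "h \<in> H" for h
    proof -
      have "nxt (opp (opp h)) \<in> S \<longleftrightarrow> opp h \<in> S"
        using assms opp_in[OF that] by (auto simp: face_unions_def)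
      then show ?thesis using opp_opp that by simp
    qed
    have inj: "inj_on nxt ?Hv"
      by (rule inj_on_subset[of nxt H]) (use bij_nxt in \<open>auto simp: bij_betw_def\<close>)
    \<comment> \<open>\<open>nxt\<close> permutes the half-edges at \<open>v\<close>, so the two
      sets whose symmetric difference is to be counted have equal size.\<close>
    have "nxt ` ?Hv = ?Hv"
      by (rule card_subset_eq)
        (use finite_H nxt_in vert_nxt inj in \<open>auto intro!: card_image\<close>)
    moreover have "nxt ` {h \<in> ?Hv. nxt h \<in> S} = nxt ` ?Hv \<inter> S" by blast
    ultimately have img: "nxt ` {h \<in> ?Hv. nxt h \<in> S} = {h \<in> ?Hv. h \<in> S}" by auto
    have "card {h \<in> ?Hv. nxt h \<in> S} = card {h \<in> ?Hv. h \<in> S}"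
      unfolding img[symmetric] 
      by (rule card_image[symmetric], rule inj_on_subset[OF inj]) blast
    moreover have "{h \<in> H. vert h = v \<and> lab h \<in> face_bd S} =
       sym_diff {h \<in> ?Hv. h \<in> S} {h \<in> ?Hv. nxt h \<in> S}"
      using face_bd_mem[OF assms] nS by auto
    ultimately show ?thesis
      using odd_card_sym_diff[of "{h \<in> ?Hv. h \<in> S}" "{h \<in> ?Hv. nxt h \<in> S}"] finite_H by auto
  qed
  then show ?thesis by (simp add: edge_bd_def)
qed

text \<open>
  In genus 0 every mod 2 cycle of edges bounds a union of faces; if all degrees are even, this
  applies to the set of all edges.
\<close>

lemma checkerboard:
  assumes euler: "card (vert ` H) + card face_orbits = card (lab ` H) + 2 * card comps"
    and even: "\<And>v. even (card {h \<in> H. vert h = v})"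
  obtains S where "\<And>h. h \<in> H \<Longrightarrow> opp h \<in> S \<longleftrightarrow> h \<notin> S" and "\<And>h. h \<in> H \<Longrightarrow> nxt h \<in> S \<longleftrightarrow> h \<notin> S"
proof -
  let ?Z = "{Y \<in> Pow (lab ` H). edge_bd Y = {}}"
  let ?k = "card {S \<in> face_unions. face_bd S = {}}"
  let ?V = "2 ^ card (vert ` H) :: nat" and ?E = "2 ^ card (lab ` H) :: nat"
    and ?C = "2 ^ card comps :: nat" and ?F = "2 ^ card face_orbits :: nat"
  have fin: "finite face_unions"
    by (rule finite_subset[of _ "Pow H"]) (auto simp: face_unions_def finite_H)
  have eq: "card face_unions = card (face_bd ` face_unions) * ?k"
  proof (rule card_additive_image[OF fin])
    have "{} \<in> face_unions" by (simp add: face_unions_def)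
    then show "face_unions \<noteq> {}" by blast
  qed (fact face_bd_additive)+
  \<comment> \<open>The boundaries have dimension at least F - C.\<close>
  have "?F \<le> card (face_bd ` face_unions) * ?C"
  proof -
    have "?F \<le> card (face_bd ` face_unions) * ?k" using card_face_orbits_le eq by simp
    also have "\<dots> \<le> card (face_bd ` face_unions) * ?C"
      using card_face_bd_kernel by (rule mult_le_mono2)
    finally show ?thesis .
  qed
  then have "?F * ?V \<le> card (face_bd ` face_unions) * ?C * ?V" by (rule mult_le_mono1)
  \<comment> \<open>Euler's formula, exponentiated. Cancelling one factor \<open>?C\<close> and
    comparing with the bound on cycles leaves at least as many boundaries as cycles.\<close>
  moreover have "?F * ?V = ?E * ?C * ?C"
  proof -
    have "card face_orbits + card (vert ` H) = card (lab ` H) + card comps + card comps"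
      using euler by simp
    then show ?thesis by (simp flip: power_add)
  qed
  ultimately have "(?E * ?C) * ?C \<le> (card (face_bd ` face_unions) * ?V) * ?C"
    by (simp only: mult.assoc mult.commute[of ?V ?C])
  then have "?E * ?C \<le> card (face_bd ` face_unions) * ?V" by simp
  with card_edge_cycles have "card ?Z * ?V \<le> card (face_bd ` face_unions) * ?V"
    by linarith
  then have le: "card ?Z \<le> card (face_bd ` face_unions)" by simp
  have "face_bd ` face_unions = ?Z"
    by (rule card_seteq[OF _ _ le]) (use finite_H face_bd_sub edge_bd_face_bd in auto)
  moreover have "lab ` H \<in> ?Z"
  proof -
    have "{h \<in> H. vert h = v \<and> lab h \<in> lab ` H} = {h \<in> H. vert h = v}" for v by blast
    then show ?thesis using even by (simp add: edge_bd_def)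
  qed
  ultimately obtain S where S: "S \<in> face_unions" "face_bd S = lab ` H" by (metis (lifting) imageE)
  have o: "opp h \<in> S \<longleftrightarrow> h \<notin> S" if "h \<in> H" for h
    using face_bd_mem[OF S(1) that] S(2) that by auto
  have "nxt h \<in> S \<longleftrightarrow> h \<notin> S" if "h \<in> H" for h
  proof -
    have "nxt (opp (opp h)) \<in> S \<longleftrightarrow> opp h \<in> S"
      using S(1) opp_in[OF that] by (auto simp: face_unions_def)
    then show ?thesis using o opp_opp that by simp
  qed
  with o show ?thesis using that by blast
qed

end

section \<open>Diagrams as combinatorial maps\<close>

lemma half_edges_Sigma:
  "half_edges D = Sigma {..<length (rotation_system D)} (\<lambda>v. {..<length (rotation_system D ! v)})"
  by (auto simp: half_edges_def)

lemma count_list_conv_card: "count_list xs x = card {i. i < length xs \<and> xs ! i = x}"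
  by (simp add: count_list_eq_length_filter length_filter_conv_card eq_commute)

lemma count_list_concat_conv_card:
  "count_list (concat xss) x = card {(v, i). v < length xss \<and> i < length (xss ! v) \<and> xss ! v ! i = x}"
proof -
  have "{(v, i). v < length xss \<and> i < length (xss ! v) \<and> xss ! v ! i = x} =
      Sigma {..<length xss} (\<lambda>v. {i. i < length (xss ! v) \<and> xss ! v ! i = x})" by auto
  then have "card {(v, i). v < length xss \<and> i < length (xss ! v) \<and> xss ! v ! i = x} =
      (\<Sum>v<length xss. count_list (xss ! v) x)"
    by (simp add: count_list_conv_card)
  also have "\<dots> = sum_list (map (\<lambda>xs. count_list xs x) xss)"
    by (simp add: sum_list_sum_nth atLeast0LessThan)
  also have "\<dots> = count_list (concat xss) x"
    by (induction xss) auto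
  finally show ?thesis ..
qed

lemma length_edges_at: "length (edges_at v) = 2 \<or> length (edges_at v) = 4"
  by (cases v) auto

lemma length_rotation_system:
  assumes "v < length (rotation_system D)"
  shows "length (rotation_system D ! v) = 2 \<or> length (rotation_system D ! v) = 4"
  using assms length_edges_at by (cases v) (auto simp: rotation_system_def)

abbreviation edge_of :: "diagram \<Rightarrow> nat \<times> nat \<Rightarrow> nat" where
  "edge_of D h \<equiv> rotation_system D ! fst h ! snd h"

lemma edges_eq_image: "edges D = edge_of D ` half_edges D"
proof -
  have "x \<in> edges D \<longleftrightarrow> x \<in> edge_of D ` half_edges D" for x
  proof -
    have "x \<in> edges D \<longleftrightarrow> (\<exists>xs\<in>set (rotation_system D). x \<in> set xs)"
      by (simp add: edges_def)
    also have "\<dots> \<longleftrightarrow> (\<exists>v<length (rotation_system D). x \<in> set (rotation_system D ! v))"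
      by (metis in_set_conv_nth)
    also have "\<dots> \<longleftrightarrow> x \<in> edge_of D ` half_edges D"
      by (force simp: half_edges_def in_set_conv_nth image_iff)
    finally show ?thesis .
  qed
  then show ?thesis by blast
qed

text \<open>Replaces the definite description by usable facts: an edge counted twice in the rotation
  system is carried by exactly two half-edges.\<close>

lemma other_end:
  assumes "edges_have_two_ends D" "h \<in> half_edges D"
  shows "other_end D h \<in> half_edges D" "other_end D h \<noteq> h"
    "h' \<in> half_edges D \<Longrightarrow> edge_of D h = edge_of D h' \<longleftrightarrow> h' = h \<or> h' = other_end D h"
proof -
  let ?A = "{k \<in> half_edges D. edge_of D k = edge_of D h}"
  have "?A = {(v, i). v < length (rotation_system D) \<and> i < length (rotation_system D ! v) \<and>
      rotation_system D ! v ! i = edge_of D h}"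
    by (auto simp: half_edges_def)
  moreover have "edge_of D h \<in> edges D" using assms(2) edges_eq_image by blast
  ultimately have "card ?A = 2"
    using assms(1) by (simp add: edges_have_two_ends_def count_list_concat_conv_card)
  then obtain a b where ab: "?A = {a, b}" "a \<noteq> b" by (auto simp: card_2_iff)
  moreover have "h \<in> ?A" using assms by simp
  ultimately obtain k where k: "?A = {h, k}" "k \<noteq> h"
    by (metis (no_types, lifting) insertE insert_commute singletonD)
  have eq: "k' \<in> half_edges D \<and> edge_of D k' = edge_of D h \<longleftrightarrow> k' = h \<or> k' = k" for k'
    using k by blast
  have "other_end D h = k"
    unfolding other_end_def by (rule the_equality) (use k eq in auto)
  then show "other_end D h \<in> half_edges D" "other_end D h \<noteq> h"
    "h' \<in> half_edges D \<Longrightarrow> edge_of D h = edge_of D h' \<longleftrightarrow> h' = h \<or> h' = other_end D h"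
    using k(2) eq[of k] eq[of h'] by (auto simp: eq_commute)
qed

lemma funpow_turn:
  "i < length (rotation_system D ! v) \<Longrightarrow>
    (turn D ^^ k) (v, i) = (v, (i + k) mod length (rotation_system D ! v))"
  by (induction k) (auto simp: turn_def mod_Suc_eq)

lemma combinatorial_map_diagram:
  assumes "edges_have_two_ends D"
  shows "combinatorial_map (half_edges D) (turn D) (other_end D) fst (edge_of D)"
proof
  show fin: "finite (half_edges D)" by (simp add: half_edges_Sigma)
  have "inj_on (turn D) (half_edges D)"
    by (rule inj_onI) (auto simp: turn_def half_edges_def mod_Suc split: if_splits)
  moreover have "turn D ` half_edges D \<subseteq> half_edges D"
    by (auto simp: turn_def half_edges_def intro!: mod_less_divisor)
  ultimately show "bij_betw (turn D) (half_edges D) (half_edges D)"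
    using endo_inj_surj[OF fin] by (simp add: bij_betw_def)
  fix h assume h: "h \<in> half_edges D"
  note o = other_end[OF assms]
  show "other_end D h \<in> half_edges D" "other_end D h \<noteq> h" using o[OF h] by blast+
  show "other_end D (other_end D h) = h"
    using o(1,2)[OF h] o(3)[OF h o(1)[OF h]] o(3)[OF o(1)[OF h] h] by auto
  show "fst (turn D h) = fst h" by (simp add: turn_def)
  fix h' assume h': "h' \<in> half_edges D"
  show "edge_of D h = edge_of D h' \<longleftrightarrow> h' = h \<or> h' = other_end D h" using o(3)[OF h h'] .
  assume "fst h = fst h'"
  then obtain v i j where ij: "h = (v, i)" "h' = (v, j)" by (metis prod.collapse)
  let ?n = "length (rotation_system D ! v)"
  \<comment> \<open>\<open>?n - i\<close> turns lead back to position 0 and \<open>j\<close> further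
    ones to position \<open>j\<close>; the sum avoids the truncated difference
    \<open>j - i\<close>.\<close>
  have "(turn D ^^ (?n - i + j)) h = h'"
    using h h' ij by (simp add: funpow_turn half_edges_def)
  then show "\<exists>n. h' = (turn D ^^ n) h" by (intro exI) (rule sym)
qed

lemma checkerboard_coloring:
  assumes "tangle_diagram D"
  obtains S where
    "\<And>h. h \<in> half_edges D \<Longrightarrow> other_end D h \<in> S \<longleftrightarrow> h \<notin> S"
    "\<And>h. h \<in> half_edges D \<Longrightarrow> turn D h \<in> S \<longleftrightarrow> h \<notin> S"
proof -
  have two: "edges_have_two_ends D" and pl: "planar D"
    using assms by (auto simp: tangle_diagram_def)
  interpret combinatorial_map "half_edges D" "turn D" "other_end D" fst "edge_of D"
    by (rule combinatorial_map_diagram[OF two])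
  let ?n = "length (rotation_system D)"
  \<comment> \<open>Every vertex has degree 2 or 4, hence carries a half-edge; counting vertices as
    images of half-edges misses none.\<close>
  have V: "fst ` half_edges D = {..<?n}"
  proof -
    have "v \<in> fst ` half_edges D" if "v < ?n" for v
    proof -
      have "(v, 0) \<in> half_edges D"
        using that length_rotation_system[OF that] by (auto simp: half_edges_def)
      then show ?thesis by (metis fst_conv imageI)
    qed
    then show ?thesis by (auto simp: half_edges_def)
  qed
  have "adj \<subseteq> adjacency D"
  proof
    fix p assume "p \<in> adj"
    then obtain h where h: "h \<in> half_edges D" "p = (fst h, fst (other_end D h))"
      by (auto simp: adj_def)
    have "edge_of D h \<in> set (rotation_system D ! fst h)"
      using h by (auto simp: half_edges_def)
    moreover have "edge_of D h = edge_of D (other_end D h)"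
      using lab_eq h opp_in by blast
    then have "edge_of D h \<in> set (rotation_system D ! fst (other_end D h))"
      using opp_in[OF h(1)] by (auto simp: half_edges_def)
    ultimately show "p \<in> adjacency D"
      using h opp_in[OF h(1)] by (auto simp: adjacency_def half_edges_def)
  qed
  \<comment> \<open>\<open>adjacency\<close> is reflexive and \<open>adj\<close> need not be, so the
    relations are compared through their closures. Two half-edges with a common edge either coincide
    or are opposite.\<close>
  moreover have "adjacency D \<subseteq> adj\<^sup>*"
  proof (rule subrelI)
    fix u v assume uv: "(u, v) \<in> adjacency D"
    then obtain x where x: "x \<in> set (rotation_system D ! u)" "x \<in> set (rotation_system D ! v)"
      by (auto simp: adjacency_def)
    obtain i where i: "i < length (rotation_system D ! u)" "rotation_system D ! u ! i = x"
      using x by (auto simp: in_set_conv_nth)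
    obtain j where j: "j < length (rotation_system D ! v)" "rotation_system D ! v ! j = x"
      using x by (auto simp: in_set_conv_nth)
    have H: "(u, i) \<in> half_edges D" "(v, j) \<in> half_edges D"
      using uv i j by (auto simp: half_edges_def adjacency_def)
    have "(v, j) = (u, i) \<or> (v, j) = other_end D (u, i)"
      using lab_eq[OF H] i j by simp
    then show "(u, v) \<in> adj\<^sup>*"
    proof
      assume "(v, j) = other_end D (u, i)"
      then have "(u, v) = (fst (u, i), fst (other_end D (u, i)))" by (metis fst_conv)
      also have "\<dots> \<in> adj" unfolding adj_def using H(1) by (rule imageI)
      finally show ?thesis by blast
    qed simp
  qed
  ultimately have "(adjacency D)\<^sup>* = adj\<^sup>*" by (metis rtrancl_subset)
  then have comps: "components D = comps" by (simp add: components_def V)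
  have "card (fst ` half_edges D) + card face_orbits
      = card (edge_of D ` half_edges D) + 2 * card comps"
    using pl by (simp add: planar_def faces_def comps V edges_eq_image)
  moreover have "even (card {h \<in> half_edges D. fst h = v})" for v
  proof (cases "v < ?n")
    case True
    have "{h \<in> half_edges D. fst h = v} = Pair v ` {..<length (rotation_system D ! v)}"
      using True by (auto simp: half_edges_def)
    then have "card {h \<in> half_edges D. fst h = v} = length (rotation_system D ! v)"
      by (simp add: card_image inj_on_def)
    then show ?thesis using length_rotation_system[OF True] by auto
  next
    case False
    then have "{h \<in> half_edges D. fst h = v} = {}" by (auto simp: half_edges_def)
    then show ?thesis by (simp only: card.empty even_zero)
  qed
  ultimately show ?thesis using checkerboard that by blast
qed

text \<open>
  With signs given by the checkerboard coloring of the faces, every edge contributes to the sum over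
  all half-edges twice with opposite signs, while the sum around a vertex is the alternating sum of
  its colors.
\<close>

lemma alternating_sum:
  fixes D :: diagram and \<kappa> :: "nat \<Rightarrow> int"
  assumes D: "tangle_diagram D" and col: "coloring D \<kappa>"
  shows "\<kappa> (NW D) - \<kappa> (NE D) + \<kappa> (SE D) - \<kappa> (SW D) = 0"
proof -
  have two: "edges_have_two_ends D" using D by (simp add: tangle_diagram_def)
  interpret combinatorial_map "half_edges D" "turn D" "other_end D" fst "edge_of D"
    by (rule combinatorial_map_diagram[OF two])
  obtain S where opp: "\<And>h. h \<in> half_edges D \<Longrightarrow> other_end D h \<in> S \<longleftrightarrow> h \<notin> S"
    and turn: "\<And>h. h \<in> half_edges D \<Longrightarrow> turn D h \<in> S \<longleftrightarrow> h \<notin> S"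
    using checkerboard_coloring[OF D] by blast
  define s where "s h = (if h \<in> S then 1 else - 1 :: int)" for h
  let ?f = "\<lambda>h. s h * \<kappa> (edge_of D h)"
  let ?rs = "rotation_system D"
  have "(\<Sum>h\<in>half_edges D. ?f h) = (\<Sum>h\<in>half_edges D. ?f (other_end D h))"
    by (rule sum.reindex_bij_witness[where i = "other_end D" and j = "other_end D"])
      (auto simp: opp_in opp_opp)
  also have "\<dots> = (\<Sum>h\<in>half_edges D. - ?f h)"
  proof (rule sum.cong[OF refl])
    fix h assume h: "h \<in> half_edges D"
    have "edge_of D h = edge_of D (other_end D h)" using lab_eq h opp_in by blast
    then show "?f (other_end D h) = - ?f h" using opp[OF h] by (simp add: s_def)
  qed
  also have "\<dots> = - (\<Sum>h\<in>half_edges D. ?f h)" by (simp add: sum_negf)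
  finally have total: "(\<Sum>h\<in>half_edges D. ?f h) = 0" by simp
  have step: "s (v, Suc i) = - s (v, i)" if "v < length ?rs" "Suc i < length (?rs ! v)" for v i
    using turn[of "(v, i)"] that by (auto simp: s_def turn_def half_edges_def)
  \<comment> \<open>Index 0 is the collapsed boundary circle, where no coloring condition is
    imposed. All other vertices contribute nothing, so its alternating sum is what remains of the
    total.\<close>
  have local: "(\<Sum>i<length (?rs ! v). ?f (v, i)) = 0" if v: "v < length ?rs" "v \<noteq> 0" for v
  proof -
    obtain w where w: "?rs ! v = edges_at w" "w \<in> set (vertices D)"
      using v by (cases v) (auto simp: rotation_system_def)
    have "colored_at \<kappa> w" using col w by (simp add: coloring_def)
    show ?thesis
    proof (cases w)
      case (Crossing i j k l)
      have "(\<Sum>i<length (?rs ! v). ?f (v, i)) = s (v, 0) * (\<kappa> i - \<kappa> j + \<kappa> k - \<kappa> l)"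
        using w Crossing step[OF v(1), of 0] step[OF v(1), of 1] step[OF v(1), of 2]
        by (simp add: numeral_eq_Suc algebra_simps)
      then show ?thesis using \<open>colored_at \<kappa> w\<close> Crossing by simp
    next
      case (Joint a b)
      then show ?thesis using w step[OF v(1), of 0] \<open>colored_at \<kappa> w\<close> by simp
    qed
  qed
  have "(\<Sum>h\<in>half_edges D. ?f h) = (\<Sum>v<length ?rs. \<Sum>i<length (?rs ! v). ?f (v, i))"
    by (simp add: half_edges_Sigma sum.Sigma split_beta)
  also have "\<dots> = (\<Sum>v\<in>{0}. \<Sum>i<length (?rs ! v). ?f (v, i))"
  proof (rule sum.mono_neutral_right)
    show "{0} \<subseteq> {..<length ?rs}" by (simp add: rotation_system_def)
  qed (use local in auto)
  also have "\<dots> = s (0, 0) * (\<kappa> (NW D) - \<kappa> (NE D) + \<kappa> (SE D) - \<kappa> (SW D))"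
    using step[of 0 0] step[of 0 1] step[of 0 2]
    by (simp add: rotation_system_def numeral_eq_Suc algebra_simps)
  finally show ?thesis using total by (auto simp: s_def split: if_splits)
qed

lemma diagonal_sum_rule:
  assumes "tangle_diagram D" "coloring D \<kappa>"
  shows "diagonal_sum_rule (color_matrix D \<kappa>)"
  using alternating_sum[OF assms] by (simp add: color_matrix_def)

section \<open>Transport of colorings\<close>

lemma edges_eq: "edges D = {NW D, NE D, SE D, SW D} \<union> (\<Union>v\<in>set (vertices D). set (edges_at v))"
  by (auto simp: edges_def rotation_system_def)

text \<open>In this form constancy can be compared for each color \<open>c\<close> separately and
  splits over unions of sets of edges.\<close>

lemma nonconstant_iff: "nonconstant D \<kappa> \<longleftrightarrow> \<not> (\<exists>c. \<forall>x\<in>edges D. \<kappa> x = c)"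
proof -
  have "NW D \<in> edges D" by (simp add: edges_eq)
  then show ?thesis unfolding nonconstant_def by metis
qed

lemma colored_at_cong:
  "(\<And>x. x \<in> set (edges_at v) \<Longrightarrow> \<kappa> x = \<kappa>' x) \<Longrightarrow> colored_at \<kappa> v \<longleftrightarrow> colored_at \<kappa>' v"
  by (cases v) auto

lemma coloring_cong:
  assumes "\<And>x. x \<in> edges D \<Longrightarrow> \<kappa> x = \<kappa>' x"
  shows "coloring D \<kappa> \<longleftrightarrow> coloring D \<kappa>'" "color_matrix D \<kappa> = color_matrix D \<kappa>'"
    "nonconstant D \<kappa> \<longleftrightarrow> nonconstant D \<kappa>'"
proof -
  have "colored_at \<kappa> v \<longleftrightarrow> colored_at \<kappa>' v" if "v \<in> set (vertices D)" for v
    by (rule colored_at_cong) (use assms that in \<open>auto simp: edges_eq\<close>)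
  then show "coloring D \<kappa> \<longleftrightarrow> coloring D \<kappa>'" by (simp add: coloring_def)
qed (use assms in \<open>auto simp: color_matrix_def edges_eq nonconstant_def\<close>)

text \<open>Exactly the data on which \<open>has_fraction\<close> depends are preserved: end colors
  and constancy. Any coloring of the target is judged by carrying it back, hence the two directions
  in \<open>color_equivalent\<close>.\<close>

definition transports :: "diagram \<Rightarrow> diagram \<Rightarrow> bool" where
  "transports D D' \<longleftrightarrow> (\<forall>\<kappa>. coloring D \<kappa> \<longrightarrow>
     (\<exists>\<kappa>'. coloring D' \<kappa>' \<and> color_matrix D' \<kappa>' = color_matrix D \<kappa> \<and>
       (nonconstant D' \<kappa>' \<longleftrightarrow> nonconstant D \<kappa>)))"

definition color_equivalent :: "diagram \<Rightarrow> diagram \<Rightarrow> bool" where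
  "color_equivalent D D' \<longleftrightarrow> transports D D' \<and> transports D' D"

lemma transports_trans: "transports D D' \<Longrightarrow> transports D' D'' \<Longrightarrow> transports D D''"
  unfolding transports_def by metis

lemma color_equivalent_refl: "color_equivalent D D"
  unfolding color_equivalent_def transports_def by blast

lemma color_equivalent_sym: "color_equivalent D D' \<Longrightarrow> color_equivalent D' D"
  unfolding color_equivalent_def by blast

lemma color_equivalent_trans:
  "color_equivalent D D' \<Longrightarrow> color_equivalent D' D'' \<Longrightarrow> color_equivalent D D''"
  unfolding color_equivalent_def using transports_trans by blast

lemma color_equivalent_same:
  assumes "color_matrix D = color_matrix D'" "edges D = edges D'"
    "\<And>\<kappa>. coloring D \<kappa> \<longleftrightarrow> coloring D' \<kappa>"
  shows "color_equivalent D D'"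
proof -
  have "coloring D = coloring D'" "nonconstant D = nonconstant D'"
    using assms by (auto simp: nonconstant_def)
  then show ?thesis unfolding color_equivalent_def transports_def assms(1) by auto
qed

lemma vertices_rename [simp]: "vertices (rename r D) = map (rename_vertex r) (vertices D)"
  and NW_rename [simp]: "NW (rename r D) = r (NW D)"
  and NE_rename [simp]: "NE (rename r D) = r (NE D)"
  and SW_rename [simp]: "SW (rename r D) = r (SW D)"
  and SE_rename [simp]: "SE (rename r D) = r (SE D)"
  by (cases D; simp)+

lemma edges_at_rename [simp]: "edges_at (rename_vertex r v) = map r (edges_at v)"
  by (cases v) auto

lemma edges_rename: "edges (rename r D) = r ` edges D"
  by (auto simp: edges_eq)

lemma colored_at_rename [simp]: "colored_at \<kappa> (rename_vertex r v) \<longleftrightarrow> colored_at (\<kappa> \<circ> r) v"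
  by (cases v) auto

lemma coloring_rename: "coloring (rename r D) \<kappa> \<longleftrightarrow> coloring D (\<kappa> \<circ> r)"
  by (simp add: coloring_def)

lemma color_matrix_rename: "color_matrix (rename r D) \<kappa> = color_matrix D (\<kappa> \<circ> r)"
  by (simp add: color_matrix_def)

lemma nonconstant_rename: "nonconstant (rename r D) \<kappa> \<longleftrightarrow> nonconstant D (\<kappa> \<circ> r)"
  by (simp add: nonconstant_def edges_rename)

lemma color_equivalent_rename:
  assumes "inj_on r (edges D)"
  shows "color_equivalent D (rename r D)"
  unfolding color_equivalent_def
proof
  show "transports (rename r D) D"
    unfolding transports_def by (metis coloring_rename color_matrix_rename nonconstant_rename)
  show "transports D (rename r D)"
    unfolding transports_def
  proof (intro allI impI exI conjI)
    fix \<kappa> assume "coloring D \<kappa>"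
    \<comment> \<open>Colorings are total functions of which only the values on edges matter, so
      inverting \<open>r\<close> on the edges suffices.\<close>
    let ?k = "\<kappa> \<circ> inv_into (edges D) r"
    have same: "\<kappa> x = (?k \<circ> r) x" if "x \<in> edges D" for x using that assms by simp
    note cong = coloring_cong[of D \<kappa> "?k \<circ> r", OF same]
    show "coloring (rename r D) ?k" "color_matrix (rename r D) ?k = color_matrix D \<kappa>"
      "nonconstant (rename r D) ?k \<longleftrightarrow> nonconstant D \<kappa>"
      using \<open>coloring D \<kappa>\<close> cong
      by (simp_all only: coloring_rename color_matrix_rename nonconstant_rename)
  qed
qed

lemma color_equivalent_reorder:
  assumes "set vs = set vs'"
  shows "color_equivalent (Diagram vs nw ne sw se) (Diagram vs' nw ne sw se)"
  by (rule color_equivalent_same) (auto simp: assms edges_eq coloring_def color_matrix_def)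

text \<open>A coloring agrees on \<open>a\<close> and \<open>b\<close>, so identifying them loses no
  color. As \<open>a\<close> and \<open>b\<close> differ, the second end of \<open>b\<close> lies
  outside the joint; the common color thus survives on an edge and constancy is preserved.\<close>

lemma color_equivalent_joint_removal:
  assumes "a \<noteq> b" and two: "edges_have_two_ends (Diagram (Joint a b # vs) nw ne sw se)"
  shows "color_equivalent (Diagram (Joint a b # vs) nw ne sw se)
    (rename (id(b := a)) (Diagram vs nw ne sw se))" (is "color_equivalent ?D (rename ?r ?D')")
proof -
  have "b \<in> edges ?D'"
  proof -
    have "b \<in> edges ?D" by (simp add: edges_eq)
    then have "count_list ([nw, ne, se, sw] @ [a, b] @ concat (map edges_at vs)) b = 2"
      using two by (simp add: edges_have_two_ends_def rotation_system_def)
    then have "count_list ([nw, ne, se, sw] @ concat (map edges_at vs)) b \<noteq> 0"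
      using \<open>a \<noteq> b\<close> by (simp split: if_splits)
    then have "b \<in> set ([nw, ne, se, sw] @ concat (map edges_at vs))"
      by (metis count_notin)
    then show ?thesis by (auto simp: edges_eq)
  qed
  then have edges: "?r ` edges ?D' \<union> {b} = edges ?D"
    by (auto simp: edges_eq image_iff)
  have nonconst: "nonconstant (rename ?r ?D') \<kappa> \<longleftrightarrow> nonconstant ?D \<kappa>" if "\<kappa> a = \<kappa> b" for \<kappa>
  proof -
    have "a \<in> ?r ` edges ?D'" using \<open>b \<in> edges ?D'\<close> by (auto simp: image_iff)
    then show ?thesis
      unfolding nonconstant_iff edges_rename using edges that by (metis Un_iff singletonD singletonI)
  qed
  have r: "\<kappa> \<circ> ?r = \<kappa>" if "\<kappa> a = \<kappa> b" for \<kappa> :: "nat \<Rightarrow> int"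
    using that by auto
  show ?thesis
    unfolding color_equivalent_def
  proof
    show "transports ?D (rename ?r ?D')"
      unfolding transports_def
    proof (intro allI impI)
      fix \<kappa> assume col: "coloring ?D \<kappa>"
      then have ab: "\<kappa> a = \<kappa> b" by (simp add: coloring_def)
      have "coloring (rename ?r ?D') \<kappa> \<and> color_matrix (rename ?r ?D') \<kappa> = color_matrix ?D \<kappa>"
        unfolding coloring_rename color_matrix_rename r[OF ab]
        using col by (simp add: coloring_def color_matrix_def)
      then show "\<exists>\<kappa>'. coloring (rename ?r ?D') \<kappa>' \<and>
          color_matrix (rename ?r ?D') \<kappa>' = color_matrix ?D \<kappa> \<and>
          (nonconstant (rename ?r ?D') \<kappa>' \<longleftrightarrow> nonconstant ?D \<kappa>)"
        using nonconst[OF ab] by blast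
    qed
    show "transports (rename ?r ?D') ?D"
      unfolding transports_def
    proof (intro allI impI)
      fix \<kappa> assume col: "coloring (rename ?r ?D') \<kappa>"
      let ?k = "\<kappa> \<circ> ?r"
      have ab: "?k a = ?k b" by simp
      have "coloring ?D ?k \<and> color_matrix ?D ?k = color_matrix (rename ?r ?D') \<kappa>"
        using col unfolding coloring_rename color_matrix_rename
        by (simp add: coloring_def color_matrix_def)
      moreover have "nonconstant ?D ?k \<longleftrightarrow> nonconstant (rename ?r ?D') \<kappa>"
        using nonconst[OF ab] unfolding nonconstant_rename r[OF ab] ..
      ultimately show "\<exists>\<kappa>'. coloring ?D \<kappa>' \<and>
          color_matrix ?D \<kappa>' = color_matrix (rename ?r ?D') \<kappa> \<and>
          (nonconstant ?D \<kappa>' \<longleftrightarrow> nonconstant (rename ?r ?D') \<kappa>)"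
        by blast
    qed
  qed
qed

section \<open>Colorings under moves inside a disc\<close>

abbreviation edge_list :: "vertex list \<Rightarrow> nat list" where
  "edge_list us \<equiv> concat (map edges_at us)"

text \<open>
  A transported coloring may differ only on edges with both ends inside the disc of the move.
\<close>

definition local_transport :: "vertex list \<Rightarrow> vertex list \<Rightarrow> bool" where
  "local_transport us us' \<longleftrightarrow> (\<forall>\<kappa>. (\<forall>v\<in>set us. colored_at \<kappa> v) \<longrightarrow>
     (\<exists>\<kappa>'. (\<forall>v\<in>set us'. colored_at \<kappa>' v) \<and>
       (\<forall>x. \<kappa>' x \<noteq> \<kappa> x \<longrightarrow> 2 \<le> count_list (edge_list us') x) \<and>
       (\<forall>c. (\<forall>x\<in>set (edge_list us). \<kappa> x = c) \<longleftrightarrow> (\<forall>x\<in>set (edge_list us'). \<kappa>' x = c))))"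

text \<open>A recolored edge has two ends inside the disc and two ends altogether, hence none
  outside: the rest of the diagram and the endpoints keep their colors.\<close>

lemma transports_local:
  assumes loc: "local_transport us us'"
    and two: "edges_have_two_ends (Diagram (us' @ vs) nw ne sw se)"
  shows "transports (Diagram (us @ vs) nw ne sw se) (Diagram (us' @ vs) nw ne sw se)"
    (is "transports ?D ?D'")
  unfolding transports_def
proof (intro allI impI)
  fix \<kappa> assume col: "coloring ?D \<kappa>"
  then have "\<forall>v\<in>set us. colored_at \<kappa> v" by (simp add: coloring_def)
  from loc[unfolded local_transport_def, THEN spec, THEN mp, OF this]
  obtain \<kappa>' where k: "\<forall>v\<in>set us'. colored_at \<kappa>' v"
    "\<forall>x. \<kappa>' x \<noteq> \<kappa> x \<longrightarrow> 2 \<le> count_list (edge_list us') x"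
    "\<forall>c. (\<forall>x\<in>set (edge_list us). \<kappa> x = c) \<longleftrightarrow> (\<forall>x\<in>set (edge_list us'). \<kappa>' x = c)"
    by (elim exE conjE) (rule that)
  let ?rest = "[nw, ne, se, sw] @ edge_list vs"
  have same: "\<kappa>' x = \<kappa> x" if x: "x \<in> set ?rest" for x
  proof (rule ccontr)
    assume "\<kappa>' x \<noteq> \<kappa> x"
    then have ge: "2 \<le> count_list (edge_list us') x" using k(2) by simp
    have rest: "count_list ?rest x \<noteq> 0" using x count_list_0_iff by metis
    have "x \<in> edges ?D'" using x by (auto simp: edges_eq)
    then have "count_list (concat (rotation_system ?D')) x = 2"
      using two by (simp only: edges_have_two_ends_def)
    moreover have "concat (rotation_system ?D') = [nw, ne, se, sw] @ edge_list us' @ edge_list vs"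
      by (simp add: rotation_system_def)
    ultimately have "count_list (edge_list us') x + count_list ?rest x = 2"
      by (simp only: count_list_append)
    then show False using ge rest by linarith
  qed
  have edges: "edges (Diagram (us @ vs) nw ne sw se) = set ?rest \<union> set (edge_list us)" for us
    by (auto simp: edges_eq)
  have "colored_at \<kappa>' v" if "v \<in> set vs" for v
  proof -
    have "colored_at \<kappa>' v \<longleftrightarrow> colored_at \<kappa> v"
      by (rule colored_at_cong) (use same that in auto)
    then show ?thesis using col that by (simp add: coloring_def)
  qed
  then have "coloring ?D' \<kappa>'" using k(1) by (auto simp: coloring_def)
  moreover have "color_matrix ?D' \<kappa>' = color_matrix ?D \<kappa>"
    using same by (simp add: color_matrix_def)
  moreover have "(\<forall>x\<in>edges ?D'. \<kappa>' x = c) \<longleftrightarrow> (\<forall>x\<in>edges ?D. \<kappa> x = c)" for c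
    unfolding edges ball_Un k(3)[THEN spec, of c] using same by simp
  then have "nonconstant ?D' \<kappa>' \<longleftrightarrow> nonconstant ?D \<kappa>" by (simp add: nonconstant_iff)
  ultimately show "\<exists>\<kappa>'. coloring ?D' \<kappa>' \<and> color_matrix ?D' \<kappa>' = color_matrix ?D \<kappa> \<and>
      (nonconstant ?D' \<kappa>' \<longleftrightarrow> nonconstant ?D \<kappa>)" by blast
qed

lemma local_transport_same:
  assumes "set (edge_list us) = set (edge_list us')"
    "\<And>\<kappa>. (\<forall>v\<in>set us. colored_at \<kappa> v) \<Longrightarrow> (\<forall>v\<in>set us'. colored_at \<kappa> v)"
  shows "local_transport us us'"
  unfolding local_transport_def
  by (intro allI impI exI conjI) (use assms in auto)

text \<open>
  The list \<open>xs\<close> contains the edges created by the move and \<open>vals\<close> their colors.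
\<close>

lemma local_transport_update:
  fixes vals :: "(nat \<Rightarrow> int) \<Rightarrow> int list"
  assumes mset: "mset (edge_list us') = mset (xs @ xs @ M)"
    and count: "\<And>x. count_list (edge_list us') x \<le> 2"
    and len: "\<And>\<kappa>. length (vals \<kappa>) = length xs"
    and upd: "\<And>\<kappa> \<kappa>'. \<forall>v\<in>set us. colored_at \<kappa> v \<Longrightarrow>
       map \<kappa>' xs = vals \<kappa> \<Longrightarrow> map \<kappa>' M = map \<kappa> M \<Longrightarrow>
       (\<forall>v\<in>set us'. colored_at \<kappa>' v) \<and>
       (\<forall>c. (\<forall>w\<in>set (edge_list us). \<kappa> w = c) \<longleftrightarrow> (\<forall>w\<in>set (edge_list us'). \<kappa>' w = c))"
  shows "local_transport us us'"
  unfolding local_transport_def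
proof (intro allI impI)
  have sum: "count_list (edge_list us') x = 2 * count_list xs x + count_list M x" for x
    by (simp add: mset flip: count_mset)
  have pos: "1 \<le> count_list xs x" if "x \<in> set xs" for x
    using that count_list_0_iff[of xs x] by (cases "count_list xs x") auto
  have "count_list xs x = 1 \<and> count_list M x = 0" if "x \<in> set xs" for x
    using count[of x] sum[of x] pos[OF that] by linarith
  \<comment> \<open>The bound 2 is used up by \<open>xs @ xs\<close>, so the new edges are distinct
    and avoid \<open>M\<close>. The border list \<open>M\<close> may have repetitions, since border
    edges of the disc can coincide.\<close>
  then have fresh: "distinct xs" "\<And>x. x \<in> set xs \<Longrightarrow> x \<notin> set M"
    by (auto simp: distinct_count_atmost_1 count_mset count_list_0_iff)
  fix \<kappa> assume col: "\<forall>v\<in>set us. colored_at \<kappa> v"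
  define k where "k w = (if w \<in> set xs then the (map_of (zip xs (vals \<kappa>)) w) else \<kappa> w)" for w
  have "map k xs = vals \<kappa>"
    by (rule nth_equalityI) (use len fresh in \<open>auto simp: k_def map_of_zip_nth\<close>)
  moreover have "map k M = map \<kappa> M" using fresh by (auto simp: k_def)
  ultimately have k: "\<forall>v\<in>set us'. colored_at k v"
    "\<forall>c. (\<forall>w\<in>set (edge_list us). \<kappa> w = c) \<longleftrightarrow> (\<forall>w\<in>set (edge_list us'). k w = c)"
    using upd[OF col] by blast+
  have "2 \<le> count_list (edge_list us') w" if "k w \<noteq> \<kappa> w" for w
  proof -
    have "w \<in> set xs" using that by (auto simp: k_def split: if_splits)
    then show ?thesis using sum[of w] pos[of w] by linarith
  qed
  with k show "\<exists>\<kappa>'. (\<forall>v\<in>set us'. colored_at \<kappa>' v) \<and>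
       (\<forall>w. \<kappa>' w \<noteq> \<kappa> w \<longrightarrow> 2 \<le> count_list (edge_list us') w) \<and>
       (\<forall>c. (\<forall>w\<in>set (edge_list us). \<kappa> w = c) \<longleftrightarrow> (\<forall>w\<in>set (edge_list us'). \<kappa>' w = c))"
    by (intro exI[of _ k]) blast
qed

lemma count_edge_list_switch:
  "count_list (edge_list (map switch_vertex us)) x = count_list (edge_list us) x"
proof -
  have "count_list (edges_at (switch_vertex v)) x = count_list (edges_at v) x" for v
    by (cases v) auto
  then show ?thesis by (induction us) auto
qed

text \<open>The crossing relations force the colors of the inner edges, and those left over hold
  because reflection of x in y, 2y - x, is an involution fixing y and distributes over itself
  (second, first and third Reidemeister move). All conditions are linear. The mirrored claims use
  the same moves with over and under exchanged.\<close>

lemma local_move_transport: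
  assumes "local_move us us'"
    and "\<And>x. count_list (edge_list us) x \<le> 2" and "\<And>x. count_list (edge_list us') x \<le> 2"
  shows "local_transport us us' \<and> local_transport us' us \<and>
    local_transport (map switch_vertex us) (map switch_vertex us') \<and>
    local_transport (map switch_vertex us') (map switch_vertex us)"
proof -
  have count_switch: "count_list (edge_list (map switch_vertex us)) x \<le> 2"
    if "\<And>x. count_list (edge_list us) x \<le> 2" for us x
    using that by (simp only: count_edge_list_switch)
  note simps = edges_at.simps switch_vertex.simps colored_at.simps
    list.map list.set concat.simps append.simps ball_simps list.inject
  from assms show ?thesis
  proof (induction rule: local_move.induct)
    case (crossing_symmetry i j k l)
    then show ?case by (intro conjI) (rule local_transport_same; force)+
  next
    case (joint_symmetry a b)
    then show ?case by (intro conjI) (rule local_transport_same; force)+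
  next
    case (R1_under_over a b c)
    note count = R1_under_over R1_under_over[THEN count_switch]
    note update = local_transport_update[where M = "[a, b]"]
    show ?case
      apply (intro conjI)
      subgoal by (rule update[where xs = "[c]" and vals = "\<lambda>\<kappa>. [\<kappa> a]"])
          (simp, rule count, simp, (simp only: simps; safe; linarith))
      subgoal by (rule update[where xs = "[]" and vals = "\<lambda>_. []"])
          (simp, rule count, simp, (simp only: simps; safe; linarith))
      subgoal by (rule update[where xs = "[c]" and vals = "\<lambda>\<kappa>. [\<kappa> a]"])
          (simp, rule count, simp, (simp only: simps; safe; linarith))
      subgoal by (rule update[where xs = "[]" and vals = "\<lambda>_. []"])
          (simp, rule count, simp, (simp only: simps; safe; linarith))
      done
  next
    case (R1_over_under a b c)
    note count = R1_over_under R1_over_under[THEN count_switch]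
    note update = local_transport_update[where M = "[a, b]"]
    show ?case
      apply (intro conjI)
      subgoal by (rule update[where xs = "[c]" and vals = "\<lambda>\<kappa>. [\<kappa> a]"])
          (simp, rule count, simp, (simp only: simps; safe; linarith))
      subgoal by (rule update[where xs = "[]" and vals = "\<lambda>_. []"])
          (simp, rule count, simp, (simp only: simps; safe; linarith))
      subgoal by (rule update[where xs = "[c]" and vals = "\<lambda>\<kappa>. [\<kappa> a]"])
          (simp, rule count, simp, (simp only: simps; safe; linarith))
      subgoal by (rule update[where xs = "[]" and vals = "\<lambda>_. []"])
          (simp, rule count, simp, (simp only: simps; safe; linarith))
      done
  next
    case (R2 a b c d e f)
    note count = R2 R2[THEN count_switch]
    note update = local_transport_update[where M = "[a, b, c, d]"]
    show ?case
      apply (intro conjI)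
      \<comment> \<open>\<open>e\<close> continues the overstrand from \<open>a\<close>, and
        \<open>f\<close> is the reflection of \<open>c\<close> in it. After switching,
        \<open>f\<close> continues the overstrand from \<open>c\<close> and \<open>e\<close> is the
        reflection of \<open>a\<close>.\<close>
      subgoal by (rule update[where xs = "[e, f]" and vals = "\<lambda>\<kappa>. [\<kappa> a, 2 * \<kappa> a - \<kappa> c]"])
          (simp, rule count, simp, (simp only: simps; safe; linarith))
      subgoal by (rule update[where xs = "[]" and vals = "\<lambda>_. []"])
          (simp, rule count, simp, (simp only: simps; safe; linarith))
      subgoal by (rule update[where xs = "[e, f]" and vals = "\<lambda>\<kappa>. [2 * \<kappa> c - \<kappa> a, \<kappa> c]"])
          (simp, rule count, simp, (simp only: simps; safe; linarith))
      subgoal by (rule update[where xs = "[]" and vals = "\<lambda>_. []"])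
          (simp, rule count, simp, (simp only: simps; safe; linarith))
      done
  next
    case (R3_tmb m1 t2 m2 t1 b1 t3 b2 m3 b3)
    note count = R3_tmb R3_tmb[THEN count_switch]
    \<comment> \<open>The sides of the triangle keep their names but are different segments before
      and after the move, so all three are recolored from the six border edges.\<close>
    note update = local_transport_update[where xs = "[t2, m2, b2]" and M = "[t1, t3, m1, m3, b1, b3]"]
    show ?case
      apply (intro conjI)
      subgoal by (rule update[where vals = "\<lambda>\<kappa>. [\<kappa> t1, \<kappa> m1, 2 * \<kappa> t1 - \<kappa> b3]"])
          (simp, rule count, simp, (simp only: simps; safe; linarith))
      subgoal by (rule update[where vals = "\<lambda>\<kappa>. [\<kappa> t1, \<kappa> m3, 2 * \<kappa> t1 - \<kappa> b1]"])
          (simp, rule count, simp, (simp only: simps; safe; linarith))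
      subgoal by (rule update[where vals = "\<lambda>\<kappa>. [2 * \<kappa> b3 - \<kappa> t1, \<kappa> m3, \<kappa> b3]"])
          (simp, rule count, simp, (simp only: simps; safe; linarith))
      subgoal by (rule update[where vals = "\<lambda>\<kappa>. [2 * \<kappa> m1 - \<kappa> t1, \<kappa> m1, \<kappa> b1]"])
          (simp, rule count, simp, (simp only: simps; safe; linarith))
      done
  next
    case (R3_tbm b1 t2 b2 t1 m1 t3 m2 b3 m3)
    note count = R3_tbm R3_tbm[THEN count_switch]
    note update = local_transport_update[where xs = "[t2, m2, b2]" and M = "[t1, t3, m1, m3, b1, b3]"]
    show ?case
      apply (intro conjI)
      subgoal by (rule update[where vals = "\<lambda>\<kappa>. [\<kappa> t1, \<kappa> m1, 2 * \<kappa> t1 - \<kappa> b3]"])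
          (simp, rule count, simp, (simp only: simps; safe; linarith))
      subgoal by (rule update[where vals = "\<lambda>\<kappa>. [\<kappa> t1, \<kappa> m3, 2 * \<kappa> t1 - \<kappa> b1]"])
          (simp, rule count, simp, (simp only: simps; safe; linarith))
      subgoal by (rule update[where vals = "\<lambda>\<kappa>. [2 * \<kappa> m3 - \<kappa> t1, \<kappa> m3, \<kappa> b3]"])
          (simp, rule count, simp, (simp only: simps; safe; linarith))
      subgoal by (rule update[where vals = "\<lambda>\<kappa>. [2 * \<kappa> b1 - \<kappa> t1, \<kappa> m1, \<kappa> b1]"])
          (simp, rule count, simp, (simp only: simps; safe; linarith))
      done
  qed
qed

section \<open>Isotopy invariance, also for mirror images\<close>

lemma vertices_mirror [simp]: "vertices (mirror D) = map switch_vertex (vertices D)"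
  and NW_mirror [simp]: "NW (mirror D) = NW D"
  and NE_mirror [simp]: "NE (mirror D) = NE D"
  and SW_mirror [simp]: "SW (mirror D) = SW D"
  and SE_mirror [simp]: "SE (mirror D) = SE D"
  by (cases D; simp)+

lemma set_edges_at_switch [simp]: "set (edges_at (switch_vertex v)) = set (edges_at v)"
  by (cases v) auto

lemma edges_mirror [simp]: "edges (mirror D) = edges D"
  by (simp add: edges_eq)

lemma edges_have_two_ends_mirror [simp]: "edges_have_two_ends (mirror D) \<longleftrightarrow> edges_have_two_ends D"
proof -
  have "count_list (concat (rotation_system (mirror D))) x
      = count_list (concat (rotation_system D)) x" for x
    by (simp add: rotation_system_def count_edge_list_switch[unfolded map_map])
  then show ?thesis by (simp add: edges_have_two_ends_def)
qed

lemma switch_vertex_rename: "switch_vertex (rename_vertex r v) = rename_vertex r (switch_vertex v)"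
  by (cases v) auto

lemma mirror_rename: "mirror (rename r D) = rename r (mirror D)"
  by (cases D) (simp add: switch_vertex_rename)

text \<open>Carrying the mirrored statement along serves mirror images of rational tangles: their
  colorings are compared directly, in place of turning an isotopy into an isotopy of the mirrored
  diagrams.\<close>

lemma move_color_equivalent:
  assumes "move D D'" "edges_have_two_ends D" "edges_have_two_ends D'"
  shows "color_equivalent D D' \<and> color_equivalent (mirror D) (mirror D')"
  using assms
proof (induction rule: move.induct)
  case (renaming r D)
  then show ?case by (simp add: mirror_rename color_equivalent_rename)
next
  case (reordering vs vs' nw ne sw se)
  have "set vs = set vs'" using reordering(1) by (metis set_mset_mset)
  then show ?case by (simp add: color_equivalent_reorder)
next
  case (joint_removal a b vs nw ne sw se)
  have "edges_have_two_ends (mirror (Diagram (Joint a b # vs) nw ne sw se))"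
    using joint_removal by (simp only: edges_have_two_ends_mirror)
  then show ?case
    unfolding mirror_rename
    using joint_removal by (auto intro!: color_equivalent_joint_removal simp del: rename.simps)
next
  case (local us us' vs nw ne sw se)
  have count: "count_list (edge_list us) x \<le> 2"
    if "edges_have_two_ends (Diagram (us @ vs) nw ne sw se)" for us x
  proof (cases "x \<in> set (edge_list us)")
    case True
    then have "x \<in> edges (Diagram (us @ vs) nw ne sw se)" by (auto simp: edges_eq)
    then have "count_list (concat (rotation_system (Diagram (us @ vs) nw ne sw se))) x = 2"
      using that by (simp add: edges_have_two_ends_def)
    then show ?thesis by (simp add: rotation_system_def split: if_splits)
  qed simp
  have mirror: "mirror (Diagram (us @ vs) nw ne sw se) =
      Diagram (map switch_vertex us @ map switch_vertex vs) nw ne sw se" for us by simp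
  note t = local_move_transport[OF local(1) count[OF local(2)] count[OF local(3)]]
  have "edges_have_two_ends (mirror (Diagram (us @ vs) nw ne sw se))"
    "edges_have_two_ends (mirror (Diagram (us' @ vs) nw ne sw se))"
    using local by (simp_all only: edges_have_two_ends_mirror)
  then show ?case
    unfolding color_equivalent_def mirror using t local by (blast intro: transports_local)
qed

lemma isotopic_color_equivalent:
  assumes "isotopic D D'"
  shows "color_equivalent D D' \<and> color_equivalent (mirror D) (mirror D')"
  using assms unfolding isotopic_def
proof (induction rule: equivclp_induct)
  case base
  show ?case by (simp add: color_equivalent_refl)
next
  case (step D1 D2)
  have "color_equivalent D1 D2 \<and> color_equivalent (mirror D1) (mirror D2)"
    using step(2) move_color_equivalent color_equivalent_sym unfolding tangle_diagram_def by blast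
  then show ?case using step.IH color_equivalent_trans by blast
qed

section \<open>Twist forms\<close>

text \<open>The diagonal sum rule is part of the invariant so that it is at hand for twist diagrams,
  mirror images and rotations without a proof that these codes are planar.\<close>

definition lawful :: "diagram \<Rightarrow> qinf \<Rightarrow> bool" where
  "lawful T q \<longleftrightarrow> has_fraction T q \<and> (\<forall>\<kappa>. coloring T \<kappa> \<longrightarrow> diagonal_sum_rule (color_matrix T \<kappa>))"

text \<open>Forward transport yields a nonconstant coloring of \<open>T'\<close>; backward transport
  determines the fraction of every such coloring.\<close>

lemma lawful_color_equivalent:
  assumes "lawful T q" "color_equivalent T T'"
  shows "lawful T' q"
proof -
  have fwd: "transports T T'" and bwd: "transports T' T"
    using assms(2) by (simp_all add: color_equivalent_def)
  obtain \<kappa> where "coloring T \<kappa>" "nonconstant T \<kappa>"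
    using assms(1) unfolding lawful_def has_fraction_def by blast
  then have "\<exists>\<kappa>'. coloring T' \<kappa>' \<and> nonconstant T' \<kappa>'"
    using fwd unfolding transports_def by blast
  moreover have "diagonal_sum_rule (color_matrix T' \<kappa>) \<and>
      (nonconstant T' \<kappa> \<longrightarrow> fraction_defined T' \<kappa> \<and> fraction T' \<kappa> = q)" if "coloring T' \<kappa>" for \<kappa>
  proof -
    from bwd[unfolded transports_def, THEN spec, THEN mp, OF that]
    obtain \<kappa>' where "coloring T \<kappa>'" "color_matrix T \<kappa>' = color_matrix T' \<kappa>"
      "nonconstant T \<kappa>' \<longleftrightarrow> nonconstant T' \<kappa>"
      by blast
    then show ?thesis
      using assms(1) unfolding lawful_def has_fraction_def fraction_defined_def fraction_def by metis
  qed
  ultimately show ?thesis unfolding lawful_def has_fraction_def by blast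
qed

section \<open>Colorings of sums and products\<close>

lemma ends_tangle_sum_prod:
  "NW (tangle_sum T S) = left_edge (NW T)" "NE (tangle_sum T S) = right_edge (NE S)"
  "SW (tangle_sum T S) = left_edge (SW T)" "SE (tangle_sum T S) = right_edge (SE S)"
  "NW (tangle_prod T S) = left_edge (NW T)" "NE (tangle_prod T S) = left_edge (NE T)"
  "SW (tangle_prod T S) = right_edge (SW S)" "SE (tangle_prod T S) = right_edge (SE S)"
  by (simp_all add: tangle_sum_def tangle_prod_def Let_def)

lemma edges_tangle_sum: "edges (tangle_sum T S) = left_edge ` edges T \<union> right_edge ` edges S"
  by (auto simp: edges_eq tangle_sum_def Let_def)

lemma edges_tangle_prod: "edges (tangle_prod T S) = left_edge ` edges T \<union> right_edge ` edges S"
  by (auto simp: edges_eq tangle_prod_def Let_def)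

lemma coloring_tangle_sum:
  "coloring (tangle_sum T S) \<kappa> \<longleftrightarrow> coloring T (\<kappa> \<circ> left_edge) \<and> coloring S (\<kappa> \<circ> right_edge) \<and>
     \<kappa> (left_edge (NE T)) = \<kappa> (right_edge (NW S)) \<and> \<kappa> (left_edge (SE T)) = \<kappa> (right_edge (SW S))"
  by (auto simp: coloring_def tangle_sum_def Let_def ball_Un)

lemma coloring_tangle_prod:
  "coloring (tangle_prod T S) \<kappa> \<longleftrightarrow> coloring T (\<kappa> \<circ> left_edge) \<and> coloring S (\<kappa> \<circ> right_edge) \<and>
     \<kappa> (left_edge (SW T)) = \<kappa> (right_edge (NW S)) \<and> \<kappa> (left_edge (SE T)) = \<kappa> (right_edge (NE S))"
  by (auto simp: coloring_def tangle_prod_def Let_def ball_Un)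

text \<open>Even numbers name the edges of the first tangle and odd numbers those of the second, so
  this inverts the restriction of a coloring to both.\<close>

definition paste :: "(nat \<Rightarrow> int) \<Rightarrow> (nat \<Rightarrow> int) \<Rightarrow> nat \<Rightarrow> int" where
  "paste \<kappa> \<kappa>' x = (if even x then \<kappa> (x div 2) else \<kappa>' (x div 2))"

lemma paste_comp [simp]: "paste \<kappa> \<kappa>' \<circ> left_edge = \<kappa>" "paste \<kappa> \<kappa>' \<circ> right_edge = \<kappa>'"
  by (auto simp: paste_def left_edge_def right_edge_def)

lemma paste_left [simp]: "paste \<kappa> \<kappa>' (left_edge x) = \<kappa> x"
  and paste_right [simp]: "paste \<kappa> \<kappa>' (right_edge x) = \<kappa>' x"
  by (simp_all add: paste_def left_edge_def right_edge_def)

fun sign_int :: "sign \<Rightarrow> int" where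
  "sign_int Pos = 1"
| "sign_int Neg = - 1"

lemma sign_value_eq: "sign_value s = Fin (of_int (sign_int s))"
  by (cases s) auto

lemma sign_int_cases: "sign_int s = 1 \<or> sign_int s = - 1"
  by (cases s) auto

lemma unit_ends [simp]:
  "NW (unit_tangle s) = 0" "NE (unit_tangle s) = 1" "SW (unit_tangle s) = 2" "SE (unit_tangle s) = 3"
  by (cases s; simp)+

lemma edges_unit: "edges (unit_tangle s) = {0, 1, 2, 3}"
  by (cases s) (auto simp: edges_eq)

text \<open>Both crossings in one form: the diagonal sum rule together with fraction 1 or -1,
  cleared of denominators.\<close>

lemma coloring_unit:
  "coloring (unit_tangle s) \<kappa> \<longleftrightarrow> \<kappa> 0 + \<kappa> 3 = \<kappa> 1 + \<kappa> 2 \<and> \<kappa> 1 - \<kappa> 0 = sign_int s * (\<kappa> 1 - \<kappa> 3)"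
  by (cases s) (auto simp: coloring_def)

definition unit_coloring :: "int \<Rightarrow> int \<Rightarrow> int \<Rightarrow> int \<Rightarrow> nat \<Rightarrow> int" where
  "unit_coloring a b c d x = (if x = 0 then a else if x = 1 then b else if x = 2 then c else d)"

lemma unit_coloring_simps [simp]:
  "unit_coloring a b c d 0 = a" "unit_coloring a b c d 1 = b" "unit_coloring a b c d (Suc 0) = b"
  "unit_coloring a b c d 2 = c" "unit_coloring a b c d 3 = d"
  by (simp_all add: unit_coloring_def)

text \<open>The fraction as a function of x = b - a and y = b - d, on which the tangle operations
  act linearly.\<close>

definition ratio :: "int \<Rightarrow> int \<Rightarrow> qinf" where
  "ratio x y = (if y = 0 then Infty else Fin (of_int x / of_int y))"

lemma ratio_add: "ratio (x + s * y) y = ratio x y + Fin (of_int s)"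
  by (simp add: ratio_def field_simps)

lemma ratio_plus: "ratio (x + u) y = ratio x y + ratio u y"
  by (simp add: ratio_def add_divide_distrib)

text \<open>Adding \<open>s * x\<close> to \<open>y\<close> adds \<open>s\<close> to the reciprocal
  y / x. The pair (0, 0) must be excluded: there the left side takes the default
  \<open>Infty\<close>, while for \<open>s\<close> equal to 1 or -1 the right side would be
  \<open>s\<close>.\<close>

lemma ratio_harmonic:
  "x \<noteq> 0 \<or> y \<noteq> 0 \<Longrightarrow> ratio x (y + s * x) = recip (Fin (of_int s) + recip (ratio x y))"
proof -
  assume xy: "x \<noteq> 0 \<or> y \<noteq> 0"
  show ?thesis
  proof (cases "x = 0")
    case True
    then show ?thesis using xy by (simp add: ratio_def)
  next
    case False
    have "recip (ratio x y) = Fin (of_int y / of_int x)" using False by (simp add: ratio_def)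
    then have sum: "Fin (of_int s) + recip (ratio x y) = Fin (of_int (y + s * x) / of_int x)"
      using False by (simp add: field_simps)
    show ?thesis unfolding sum using False by (simp add: ratio_def del: of_int_add of_int_mult)
  qed
qed

lemma ratio_rotate: "x \<noteq> 0 \<or> y \<noteq> 0 \<Longrightarrow> ratio (- y) x = - recip (ratio x y)"
  by (auto simp: ratio_def)

lemma fraction_ratio: "fraction T \<kappa> = ratio (\<kappa> (NE T) - \<kappa> (NW T)) (\<kappa> (NE T) - \<kappa> (SE T))"
  by (simp add: fraction_def color_matrix_def ratio_def)

lemma fraction_defined_iff:
  "fraction_defined T \<kappa> \<longleftrightarrow> \<kappa> (NE T) - \<kappa> (NW T) \<noteq> 0 \<or> \<kappa> (NE T) - \<kappa> (SE T) \<noteq> 0"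
  by (simp add: fraction_defined_def color_matrix_def)

text \<open>Common scheme of the four twist operations: \<open>f\<close> and \<open>g\<close> embed
  the edges of \<open>T\<close> and of the new crossing, and \<open>F\<close> is the effect on
  fractions. By \<open>rigid\<close>, a coloring that is nonconstant on \<open>D\<close> is already
  nonconstant on \<open>T\<close>, where the fraction is known; \<open>ext\<close> provides
  existence.\<close>

lemma lawful_extend:
  assumes T: "lawful T p"
    and edges: "edges D = f ` edges T \<union> g ` edges (unit_tangle s)"
    and col: "\<And>\<kappa>. coloring D \<kappa> \<Longrightarrow> coloring T (\<kappa> \<circ> f) \<and> coloring (unit_tangle s) (\<kappa> \<circ> g)"
    and rigid: "\<And>\<kappa> c. coloring D \<kappa> \<Longrightarrow> \<forall>x\<in>edges T. \<kappa> (f x) = c \<Longrightarrow>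
        \<forall>x\<in>edges (unit_tangle s). \<kappa> (g x) = c"
    and ext: "\<And>\<kappa>. coloring T \<kappa> \<Longrightarrow> \<exists>\<kappa>'. coloring D \<kappa>' \<and> \<kappa>' \<circ> f = \<kappa>"
    and diag: "\<And>\<kappa>. coloring D \<kappa> \<Longrightarrow> diagonal_sum_rule (color_matrix T (\<kappa> \<circ> f)) \<Longrightarrow>
        diagonal_sum_rule (color_matrix D \<kappa>)"
    and frac: "\<And>\<kappa>. coloring D \<kappa> \<Longrightarrow> diagonal_sum_rule (color_matrix T (\<kappa> \<circ> f)) \<Longrightarrow>
        fraction_defined T (\<kappa> \<circ> f) \<Longrightarrow>
        fraction_defined D \<kappa> \<and> fraction D \<kappa> = F (fraction T (\<kappa> \<circ> f))"
  shows "lawful D (F p)"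
proof -
  have nonconst: "nonconstant D \<kappa> \<longleftrightarrow> nonconstant T (\<kappa> \<circ> f)" if "coloring D \<kappa>" for \<kappa>
  proof -
    have "(\<forall>x\<in>edges D. \<kappa> x = c) \<longleftrightarrow> (\<forall>x\<in>edges T. \<kappa> (f x) = c)" for c
      unfolding edges using rigid[OF that, of c] by auto
    then show ?thesis by (simp add: nonconstant_iff)
  qed
  obtain \<kappa> where "coloring T \<kappa>" "nonconstant T \<kappa>"
    using T unfolding lawful_def has_fraction_def by blast
  then have "\<exists>\<kappa>'. coloring D \<kappa>' \<and> nonconstant D \<kappa>'"
    using ext nonconst by metis
  then show ?thesis
    using T col nonconst diag frac unfolding lawful_def has_fraction_def by metis
qed

lemma lawful_add_right:
  assumes "lawful T p"
  shows "lawful (tangle_sum T (unit_tangle s)) (p + sign_value s)"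
proof (rule lawful_extend[OF assms, where f = left_edge and g = right_edge and s = s and F = "\<lambda>q. q + sign_value s"])
  let ?D = "tangle_sum T (unit_tangle s)"
  show "edges ?D = left_edge ` edges T \<union> right_edge ` edges (unit_tangle s)"
    by (rule edges_tangle_sum)
  fix \<kappa> assume "coloring ?D \<kappa>"
  then show "coloring T (\<kappa> \<circ> left_edge) \<and> coloring (unit_tangle s) (\<kappa> \<circ> right_edge)"
    by (simp add: coloring_tangle_sum)
next
  let ?D = "tangle_sum T (unit_tangle s)"
  fix \<kappa> c assume "coloring ?D \<kappa>" "\<forall>x\<in>edges T. \<kappa> (left_edge x) = c"
  then show "\<forall>x\<in>edges (unit_tangle s). \<kappa> (right_edge x) = c"
    using sign_int_cases[of s]
    by (auto simp: coloring_tangle_sum coloring_unit edges_unit edges_eq[of T])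
next
  let ?D = "tangle_sum T (unit_tangle s)"
  fix \<kappa> assume "coloring T \<kappa>"
  let ?p = "\<kappa> (NE T)" and ?q = "\<kappa> (SE T)"
  \<comment> \<open>The north and south edges of the crossing both rise by s y from west to east,
    where y = p - q is the difference on the glued side.\<close>
  let ?u = "unit_coloring ?p (?p + sign_int s * (?p - ?q)) ?q (?q + sign_int s * (?p - ?q))"
  have "coloring ?D (paste \<kappa> ?u)"
    using \<open>coloring T \<kappa>\<close> sign_int_cases[of s] by (auto simp: coloring_tangle_sum coloring_unit)
  then show "\<exists>\<kappa>'. coloring ?D \<kappa>' \<and> \<kappa>' \<circ> left_edge = \<kappa>"
    by (intro exI conjI) (assumption, simp)
next
  let ?D = "tangle_sum T (unit_tangle s)"
  fix \<kappa> assume col: "coloring ?D \<kappa>" and diag: "diagonal_sum_rule (color_matrix T (\<kappa> \<circ> left_edge))"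
  show "diagonal_sum_rule (color_matrix ?D \<kappa>)"
    using col diag sign_int_cases[of s]
    by (auto simp: coloring_tangle_sum coloring_unit color_matrix_def ends_tangle_sum_prod)
  let ?x = "\<kappa> (left_edge (NE T)) - \<kappa> (left_edge (NW T))" and ?y = "\<kappa> (left_edge (NE T)) - \<kappa> (left_edge (SE T))"
  assume "fraction_defined T (\<kappa> \<circ> left_edge)"
  then have xy: "?x \<noteq> 0 \<or> ?y \<noteq> 0" by (simp add: fraction_defined_iff)
  have x: "\<kappa> (NE ?D) - \<kappa> (NW ?D) = ?x + sign_int s * ?y" and y: "\<kappa> (NE ?D) - \<kappa> (SE ?D) = ?y"
    using col diag sign_int_cases[of s]
    by (auto simp: coloring_tangle_sum coloring_unit color_matrix_def ends_tangle_sum_prod)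
  have "fraction_defined ?D \<kappa>"
    unfolding fraction_defined_iff x y using xy by auto
  moreover have "fraction ?D \<kappa> = fraction T (\<kappa> \<circ> left_edge) + sign_value s"
    unfolding fraction_ratio x y o_apply sign_value_eq using xy by (simp only: ratio_add not_False_eq_True)
  ultimately show "fraction_defined ?D \<kappa> \<and> fraction ?D \<kappa> = fraction T (\<kappa> \<circ> left_edge) + sign_value s" ..
qed

text \<open>The crossing meets the west side of \<open>T\<close>; the diagonal sum rule of
  \<open>T\<close> turns its color difference a - c into the denominator b - d.\<close>

lemma lawful_add_left:
  assumes "lawful T p"
  shows "lawful (tangle_sum (unit_tangle s) T) (p + sign_value s)"
proof (rule lawful_extend[OF assms, where f = right_edge and g = left_edge and s = s and F = "\<lambda>q. q + sign_value s"])
  let ?D = "tangle_sum (unit_tangle s) T"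
  show "edges ?D = right_edge ` edges T \<union> left_edge ` edges (unit_tangle s)"
    by (simp add: edges_tangle_sum Un_commute)
  fix \<kappa> assume "coloring ?D \<kappa>"
  then show "coloring T (\<kappa> \<circ> right_edge) \<and> coloring (unit_tangle s) (\<kappa> \<circ> left_edge)"
    by (simp add: coloring_tangle_sum)
next
  let ?D = "tangle_sum (unit_tangle s) T"
  fix \<kappa> c assume "coloring ?D \<kappa>" "\<forall>x\<in>edges T. \<kappa> (right_edge x) = c"
  then show "\<forall>x\<in>edges (unit_tangle s). \<kappa> (left_edge x) = c"
    using sign_int_cases[of s]
    by (auto simp: coloring_tangle_sum coloring_unit edges_unit edges_eq[of T])
next
  let ?D = "tangle_sum (unit_tangle s) T"
  fix \<kappa> assume "coloring T \<kappa>"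
  let ?p = "\<kappa> (NW T)" and ?q = "\<kappa> (SW T)"
  let ?u = "unit_coloring (?p - sign_int s * (?p - ?q)) ?p (?q - sign_int s * (?p - ?q)) ?q"
  have "coloring ?D (paste ?u \<kappa>)"
    using \<open>coloring T \<kappa>\<close> sign_int_cases[of s] by (auto simp: coloring_tangle_sum coloring_unit)
  then show "\<exists>\<kappa>'. coloring ?D \<kappa>' \<and> \<kappa>' \<circ> right_edge = \<kappa>"
    by (intro exI conjI) (assumption, simp)
next
  let ?D = "tangle_sum (unit_tangle s) T"
  fix \<kappa> assume col: "coloring ?D \<kappa>" and diag: "diagonal_sum_rule (color_matrix T (\<kappa> \<circ> right_edge))"
  show "diagonal_sum_rule (color_matrix ?D \<kappa>)"
    using col diag sign_int_cases[of s]
    by (auto simp: coloring_tangle_sum coloring_unit color_matrix_def ends_tangle_sum_prod)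
  let ?x = "\<kappa> (right_edge (NE T)) - \<kappa> (right_edge (NW T))" and ?y = "\<kappa> (right_edge (NE T)) - \<kappa> (right_edge (SE T))"
  assume "fraction_defined T (\<kappa> \<circ> right_edge)"
  then have xy: "?x \<noteq> 0 \<or> ?y \<noteq> 0" by (simp add: fraction_defined_iff)
  have x: "\<kappa> (NE ?D) - \<kappa> (NW ?D) = ?x + sign_int s * ?y" and y: "\<kappa> (NE ?D) - \<kappa> (SE ?D) = ?y"
    using col diag sign_int_cases[of s]
    by (auto simp: coloring_tangle_sum coloring_unit color_matrix_def ends_tangle_sum_prod)
  have "fraction_defined ?D \<kappa>"
    unfolding fraction_defined_iff x y using xy by auto
  moreover have "fraction ?D \<kappa> = fraction T (\<kappa> \<circ> right_edge) + sign_value s"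
    unfolding fraction_ratio x y o_apply sign_value_eq using xy by (simp only: ratio_add not_False_eq_True)
  ultimately show "fraction_defined ?D \<kappa> \<and> fraction ?D \<kappa> = fraction T (\<kappa> \<circ> right_edge) + sign_value s" ..
qed

text \<open>The crossing meets the south side of \<open>T\<close>, where d - c = b - a by the
  diagonal sum rule. So x is kept and y changes by \<open>s\<close> times x.\<close>

lemma lawful_mul_below:
  assumes "lawful T p"
  shows "lawful (tangle_prod T (unit_tangle s)) (recip (sign_value s + recip p))"
proof (rule lawful_extend[OF assms, where f = left_edge and g = right_edge and s = s and F = "\<lambda>q. recip (sign_value s + recip q)"])
  let ?D = "tangle_prod T (unit_tangle s)"
  show "edges ?D = left_edge ` edges T \<union> right_edge ` edges (unit_tangle s)"
    by (rule edges_tangle_prod)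
  fix \<kappa> assume "coloring ?D \<kappa>"
  then show "coloring T (\<kappa> \<circ> left_edge) \<and> coloring (unit_tangle s) (\<kappa> \<circ> right_edge)"
    by (simp add: coloring_tangle_prod)
next
  let ?D = "tangle_prod T (unit_tangle s)"
  fix \<kappa> c assume "coloring ?D \<kappa>" "\<forall>x\<in>edges T. \<kappa> (left_edge x) = c"
  then show "\<forall>x\<in>edges (unit_tangle s). \<kappa> (right_edge x) = c"
    using sign_int_cases[of s]
    by (auto simp: coloring_tangle_prod coloring_unit edges_unit edges_eq[of T])
next
  let ?D = "tangle_prod T (unit_tangle s)"
  fix \<kappa> assume "coloring T \<kappa>"
  let ?p = "\<kappa> (SW T)" and ?q = "\<kappa> (SE T)"
  \<comment> \<open>Going down, both columns change by - s x with x = q - p; the relation of the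
    crossing then holds because s * s = 1.\<close>
  let ?u = "unit_coloring ?p ?q (?p - sign_int s * (?q - ?p)) (?q - sign_int s * (?q - ?p))"
  have "coloring ?D (paste \<kappa> ?u)"
    using \<open>coloring T \<kappa>\<close> sign_int_cases[of s] by (auto simp: coloring_tangle_prod coloring_unit)
  then show "\<exists>\<kappa>'. coloring ?D \<kappa>' \<and> \<kappa>' \<circ> left_edge = \<kappa>"
    by (intro exI conjI) (assumption, simp)
next
  let ?D = "tangle_prod T (unit_tangle s)"
  fix \<kappa> assume col: "coloring ?D \<kappa>" and diag: "diagonal_sum_rule (color_matrix T (\<kappa> \<circ> left_edge))"
  show "diagonal_sum_rule (color_matrix ?D \<kappa>)"
    using col diag sign_int_cases[of s]
    by (auto simp: coloring_tangle_prod coloring_unit color_matrix_def ends_tangle_sum_prod)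
  let ?x = "\<kappa> (left_edge (NE T)) - \<kappa> (left_edge (NW T))" and ?y = "\<kappa> (left_edge (NE T)) - \<kappa> (left_edge (SE T))"
  assume "fraction_defined T (\<kappa> \<circ> left_edge)"
  then have xy: "?x \<noteq> 0 \<or> ?y \<noteq> 0" by (simp add: fraction_defined_iff)
  have x: "\<kappa> (NE ?D) - \<kappa> (NW ?D) = ?x" and y: "\<kappa> (NE ?D) - \<kappa> (SE ?D) = ?y + sign_int s * ?x"
    using col diag sign_int_cases[of s]
    by (auto simp: coloring_tangle_prod coloring_unit color_matrix_def ends_tangle_sum_prod)
  have "fraction_defined ?D \<kappa>"
    unfolding fraction_defined_iff x y using xy by auto
  moreover have "fraction ?D \<kappa> = recip (sign_value s + recip (fraction T (\<kappa> \<circ> left_edge)))"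
    unfolding fraction_ratio x y o_apply sign_value_eq using xy by (simp only: ratio_harmonic not_False_eq_True)
  ultimately show "fraction_defined ?D \<kappa> \<and> fraction ?D \<kappa> = recip (sign_value s + recip (fraction T (\<kappa> \<circ> left_edge)))" ..
qed

lemma lawful_mul_above:
  assumes "lawful T p"
  shows "lawful (tangle_prod (unit_tangle s) T) (recip (sign_value s + recip p))"
proof (rule lawful_extend[OF assms, where f = right_edge and g = left_edge and s = s and F = "\<lambda>q. recip (sign_value s + recip q)"])
  let ?D = "tangle_prod (unit_tangle s) T"
  show "edges ?D = right_edge ` edges T \<union> left_edge ` edges (unit_tangle s)"
    by (simp add: edges_tangle_prod Un_commute)
  fix \<kappa> assume "coloring ?D \<kappa>"
  then show "coloring T (\<kappa> \<circ> right_edge) \<and> coloring (unit_tangle s) (\<kappa> \<circ> left_edge)"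
    by (simp add: coloring_tangle_prod)
next
  let ?D = "tangle_prod (unit_tangle s) T"
  fix \<kappa> c assume "coloring ?D \<kappa>" "\<forall>x\<in>edges T. \<kappa> (right_edge x) = c"
  then show "\<forall>x\<in>edges (unit_tangle s). \<kappa> (left_edge x) = c"
    using sign_int_cases[of s]
    by (auto simp: coloring_tangle_prod coloring_unit edges_unit edges_eq[of T])
next
  let ?D = "tangle_prod (unit_tangle s) T"
  fix \<kappa> assume "coloring T \<kappa>"
  let ?p = "\<kappa> (NW T)" and ?q = "\<kappa> (NE T)"
  let ?u = "unit_coloring (?p + sign_int s * (?q - ?p)) (?q + sign_int s * (?q - ?p)) ?p ?q"
  have "coloring ?D (paste ?u \<kappa>)"
    using \<open>coloring T \<kappa>\<close> sign_int_cases[of s] by (auto simp: coloring_tangle_prod coloring_unit)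
  then show "\<exists>\<kappa>'. coloring ?D \<kappa>' \<and> \<kappa>' \<circ> right_edge = \<kappa>"
    by (intro exI conjI) (assumption, simp)
next
  let ?D = "tangle_prod (unit_tangle s) T"
  fix \<kappa> assume col: "coloring ?D \<kappa>" and diag: "diagonal_sum_rule (color_matrix T (\<kappa> \<circ> right_edge))"
  show "diagonal_sum_rule (color_matrix ?D \<kappa>)"
    using col diag sign_int_cases[of s]
    by (auto simp: coloring_tangle_prod coloring_unit color_matrix_def ends_tangle_sum_prod)
  let ?x = "\<kappa> (right_edge (NE T)) - \<kappa> (right_edge (NW T))" and ?y = "\<kappa> (right_edge (NE T)) - \<kappa> (right_edge (SE T))"
  assume "fraction_defined T (\<kappa> \<circ> right_edge)"
  then have xy: "?x \<noteq> 0 \<or> ?y \<noteq> 0" by (simp add: fraction_defined_iff)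
  have x: "\<kappa> (NE ?D) - \<kappa> (NW ?D) = ?x" and y: "\<kappa> (NE ?D) - \<kappa> (SE ?D) = ?y + sign_int s * ?x"
    using col diag sign_int_cases[of s]
    by (auto simp: coloring_tangle_prod coloring_unit color_matrix_def ends_tangle_sum_prod)
  have "fraction_defined ?D \<kappa>"
    unfolding fraction_defined_iff x y using xy by auto
  moreover have "fraction ?D \<kappa> = recip (sign_value s + recip (fraction T (\<kappa> \<circ> right_edge)))"
    unfolding fraction_ratio x y o_apply sign_value_eq using xy by (simp only: ratio_harmonic not_False_eq_True)
  ultimately show "fraction_defined ?D \<kappa> \<and> fraction ?D \<kappa> = recip (sign_value s + recip (fraction T (\<kappa> \<circ> right_edge)))" ..
qed

text \<open>The witness \<open>int\<close> colors each edge by its own name, giving the two arcs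
  different colors.\<close>

lemma lawful_zero_tangle: "lawful zero_tangle (Fin 0)"
  by (auto simp: lawful_def has_fraction_def coloring_def zero_tangle_def
      nonconstant_def edges_eq color_matrix_def fraction_def fraction_defined_def
      intro!: exI[of _ int])

lemma lawful_infinity_tangle: "lawful infinity_tangle Infty"
  by (auto simp: lawful_def has_fraction_def coloring_def infinity_tangle_def
      nonconstant_def edges_eq color_matrix_def fraction_def fraction_defined_def
      intro!: exI[of _ int])

lemma lawful_twist_diagram: "lawful (twist_diagram w) (arith_fraction w)"
  by (induction w)
    (simp_all add: lawful_zero_tangle lawful_infinity_tangle
      lawful_add_right lawful_add_left lawful_mul_below lawful_mul_above)

section \<open>Mirror images and rotations\<close>

fun opposite :: "sign \<Rightarrow> sign" where
  "opposite Pos = Neg"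
| "opposite Neg = Pos"

fun mirror_form :: "twist_form \<Rightarrow> twist_form" where
  "mirror_form Zero = Zero"
| "mirror_form Infinity = Infinity"
| "mirror_form (AddRight w s) = AddRight (mirror_form w) (opposite s)"
| "mirror_form (AddLeft s w) = AddLeft (opposite s) (mirror_form w)"
| "mirror_form (MulBelow w s) = MulBelow (mirror_form w) (opposite s)"
| "mirror_form (MulAbove s w) = MulAbove (opposite s) (mirror_form w)"

lemma uminus_plus_qinf: "- (x + y) = - x + - (y :: qinf)"
  by (cases x; cases y) auto

lemma uminus_uminus_qinf: "- (- x) = (x :: qinf)"
  by (cases x) auto

lemma recip_uminus: "recip (- x) = - recip x"
  by (cases x) auto

lemma arith_fraction_mirror_form: "arith_fraction (mirror_form w) = - arith_fraction w"
proof -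
  have "sign_value (opposite s) = - sign_value s" for s by (cases s) auto
  then show ?thesis
    by (induction w) (auto simp: recip_uminus simp flip: uminus_plus_qinf)
qed

text \<open>Stronger than \<open>color_equivalent\<close>: edge names and ends agree, so sums and
  products respect it. Equality of codes would be too strong, as the mirrored positive crossing
  lists its edges from the other end of the understrand.\<close>

definition same_colorings :: "diagram \<Rightarrow> diagram \<Rightarrow> bool" where
  "same_colorings D D' \<longleftrightarrow> NW D = NW D' \<and> NE D = NE D' \<and> SW D = SW D' \<and> SE D = SE D' \<and>
     edges D = edges D' \<and> (\<forall>\<kappa>. coloring D \<kappa> \<longleftrightarrow> coloring D' \<kappa>)"

lemma same_colorings_color_equivalent: "same_colorings D D' \<Longrightarrow> color_equivalent D D'"
  by (rule color_equivalent_same) (auto simp: same_colorings_def color_matrix_def)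

lemma same_colorings_sum:
  "same_colorings T T' \<Longrightarrow> same_colorings S S' \<Longrightarrow> same_colorings (tangle_sum T S) (tangle_sum T' S')"
  by (simp add: same_colorings_def coloring_tangle_sum edges_tangle_sum ends_tangle_sum_prod)

lemma same_colorings_prod:
  "same_colorings T T' \<Longrightarrow> same_colorings S S' \<Longrightarrow> same_colorings (tangle_prod T S) (tangle_prod T' S')"
  by (simp add: same_colorings_def coloring_tangle_prod edges_tangle_prod ends_tangle_sum_prod)

lemma same_colorings_unit: "same_colorings (mirror (unit_tangle s)) (unit_tangle (opposite s))"
  by (cases s) (auto simp: same_colorings_def edges_eq coloring_def)

lemma mirror_tangle_sum: "mirror (tangle_sum T S) = tangle_sum (mirror T) (mirror S)"
  by (simp add: tangle_sum_def Let_def switch_vertex_rename)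

lemma mirror_tangle_prod: "mirror (tangle_prod T S) = tangle_prod (mirror T) (mirror S)"
  by (simp add: tangle_prod_def Let_def switch_vertex_rename)

lemma same_colorings_mirror_form:
  "same_colorings (mirror (twist_diagram w)) (twist_diagram (mirror_form w))"
proof (induction w)
  case Zero
  show ?case by (simp add: zero_tangle_def same_colorings_def)
next
  case Infinity
  show ?case by (simp add: infinity_tangle_def same_colorings_def)
qed (simp_all add: mirror_tangle_sum mirror_tangle_prod same_colorings_unit
    same_colorings_sum same_colorings_prod)

lemma ends_rotate_ccw:
  "NW (rotate_ccw T) = NE T" "NE (rotate_ccw T) = SE T"
  "SW (rotate_ccw T) = NW T" "SE (rotate_ccw T) = SW T"
  "vertices (rotate_ccw T) = vertices T"
  by (cases T; simp)+

text \<open>The new coordinates are d - b = -y and d - c, and the latter equals x by the diagonal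
  sum rule.\<close>

lemma fraction_rotate:
  assumes "diagonal_sum_rule (color_matrix T \<kappa>)" "fraction_defined T \<kappa>"
  shows "fraction_defined (rotate_ccw T) \<kappa>" "fraction (rotate_ccw T) \<kappa> = - recip (fraction T \<kappa>)"
proof -
  let ?x = "\<kappa> (NE T) - \<kappa> (NW T)" and ?y = "\<kappa> (NE T) - \<kappa> (SE T)"
  have "\<kappa> (SE T) - \<kappa> (SW T) = ?x" "\<kappa> (SE T) - \<kappa> (NE T) = - ?y"
    using assms(1) by (simp_all add: color_matrix_def)
  moreover have xy: "?x \<noteq> 0 \<or> ?y \<noteq> 0" using assms(2) by (simp only: fraction_defined_iff)
  ultimately show "fraction_defined (rotate_ccw T) \<kappa>"
    and "fraction (rotate_ccw T) \<kappa> = - recip (fraction T \<kappa>)"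
    unfolding fraction_ratio fraction_defined_iff ends_rotate_ccw using ratio_rotate[OF xy] by auto
qed

lemma lawful_rotate:
  assumes "lawful T q"
  shows "lawful (rotate_ccw T) (- recip q)"
proof -
  have edges: "edges (rotate_ccw T) = edges T"
    unfolding edges_eq ends_rotate_ccw by auto
  have col: "coloring (rotate_ccw T) \<kappa> \<longleftrightarrow> coloring T \<kappa>" for \<kappa>
    by (simp add: coloring_def ends_rotate_ccw)
  have nonconst: "nonconstant (rotate_ccw T) \<kappa> \<longleftrightarrow> nonconstant T \<kappa>" for \<kappa>
    by (simp add: nonconstant_def edges)
  have diag: "diagonal_sum_rule (color_matrix (rotate_ccw T) \<kappa>)"
    if "diagonal_sum_rule (color_matrix T \<kappa>)" for \<kappa>
    using that by (simp add: color_matrix_def ends_rotate_ccw)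
  have "\<exists>\<kappa>. coloring T \<kappa> \<and> nonconstant T \<kappa>"
    using assms unfolding lawful_def has_fraction_def by blast
  moreover have "diagonal_sum_rule (color_matrix T \<kappa>)" if "coloring T \<kappa>" for \<kappa>
    using assms that unfolding lawful_def by blast
  moreover have "fraction_defined T \<kappa>" "fraction T \<kappa> = q" if "coloring T \<kappa>" "nonconstant T \<kappa>" for \<kappa>
    using assms that unfolding lawful_def has_fraction_def by blast+
  ultimately show ?thesis
    unfolding lawful_def has_fraction_def col nonconst using fraction_rotate diag by simp
qed

section \<open>The seven properties of the fraction\<close>

theorem theorem4:
  shows
    "(\<forall>T \<kappa>. tangle_diagram T \<and> coloring T \<kappa> \<longrightarrow> diagonal_sum_rule (color_matrix T \<kappa>)) \<and>
     (\<forall>T. rational T \<longrightarrow> (\<exists>q. \<forall>T'. tangle_diagram T' \<and> isotopic T T' \<longrightarrow> has_fraction T' q)) \<and>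
     (\<forall>T S \<kappa>. tangle_diagram T \<and> tangle_diagram S \<and> coloring (tangle_sum T S) \<kappa> \<and>
        fraction_defined (tangle_sum T S) \<kappa> \<and>
        fraction_defined T (\<kappa> \<circ> left_edge) \<and> fraction_defined S (\<kappa> \<circ> right_edge) \<longrightarrow>
        fraction (tangle_sum T S) \<kappa> = fraction T (\<kappa> \<circ> left_edge) + fraction S (\<kappa> \<circ> right_edge)) \<and>
     (\<forall>T \<kappa>. tangle_diagram T \<and> coloring T \<kappa> \<and> diagonal_sum_rule (color_matrix T \<kappa>) \<and>
        fraction_defined T \<kappa> \<and> fraction_defined (rotate_ccw T) \<kappa> \<longrightarrow>
        fraction (rotate_ccw T) \<kappa> = - recip (fraction T \<kappa>)) \<and>
     (\<forall>T q. rational T \<and> has_fraction T q \<longrightarrow> has_fraction (mirror T) (- q)) \<and>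
     (\<forall>T q. rational T \<and> has_fraction T q \<longrightarrow> has_fraction (mirror (rotate_ccw T)) (recip q)) \<and>
     (\<forall>T w. rational T \<and> isotopic T (twist_diagram w) \<longrightarrow> has_fraction T (arith_fraction w))"
proof -
  have diag: "diagonal_sum_rule (color_matrix T \<kappa>)" if "tangle_diagram T" "coloring T \<kappa>" for T \<kappa>
    using diagonal_sum_rule that .
  \<comment> \<open>Having a fraction includes having a nonconstant coloring, so the value is
    determined; this identifies a given \<open>q\<close> with the arithmetical fraction.\<close>
  have unique: "p = q" if frac: "has_fraction T p" "has_fraction T q" for T p q
  proof -
    obtain \<kappa> where "coloring T \<kappa>" "nonconstant T \<kappa>"
      using frac(1) unfolding has_fraction_def by blast
    then have "fraction T \<kappa> = p" "fraction T \<kappa> = q"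
      using frac unfolding has_fraction_def by blast+
    then show ?thesis by simp
  qed
  have twist: "lawful T (arith_fraction w) \<and> lawful (mirror T) (- arith_fraction w)"
    if "isotopic T (twist_diagram w)" for T w
  proof -
    have eqv: "color_equivalent (twist_diagram w) T" "color_equivalent (mirror (twist_diagram w)) (mirror T)"
      using isotopic_color_equivalent[OF that] color_equivalent_sym by blast+
    have "lawful (mirror (twist_diagram w)) (arith_fraction (mirror_form w))"
      using lawful_twist_diagram
        color_equivalent_sym[OF same_colorings_color_equivalent[OF same_colorings_mirror_form]]
      by (rule lawful_color_equivalent)
    then show ?thesis
      using eqv lawful_twist_diagram[of w] lawful_color_equivalent
      unfolding arith_fraction_mirror_form by blast
  qed
  show ?thesis
  proof (intro conjI allI impI; (elim conjE)?)
    fix T \<kappa> assume "tangle_diagram T" "coloring T \<kappa>"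
    then show "diagonal_sum_rule (color_matrix T \<kappa>)" by (rule diag)
  next
    fix T assume "rational T"
    then obtain w where w: "isotopic T (twist_diagram w)" by (auto simp: rational_def)
    have "has_fraction T' (arith_fraction w)" if "isotopic T T'" for T'
    proof -
      have "color_equivalent T T'" using isotopic_color_equivalent that by blast
      then have "lawful T' (arith_fraction w)"
        using twist[OF w] lawful_color_equivalent by blast
      then show ?thesis by (simp add: lawful_def)
    qed
    then show "\<exists>q. \<forall>T'. tangle_diagram T' \<and> isotopic T T' \<longrightarrow> has_fraction T' q" by blast
  next
    fix T S \<kappa>
    assume T: "tangle_diagram T" and S: "tangle_diagram S" and col: "coloring (tangle_sum T S) \<kappa>"
    have "diagonal_sum_rule (color_matrix T (\<kappa> \<circ> left_edge))"
      "diagonal_sum_rule (color_matrix S (\<kappa> \<circ> right_edge))"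
      using diag T S col by (simp_all add: coloring_tangle_sum)
    \<comment> \<open>Gluing identifies the east difference of \<open>T\<close> with the west
      difference of \<open>S\<close>, which by the diagonal sum rule is the east difference of
      \<open>S\<close>. The three fractions have a common denominator and their numerators add
      up.\<close>
    then have "\<kappa> (left_edge (NE T)) - \<kappa> (left_edge (SE T)) = \<kappa> (right_edge (NE S)) - \<kappa> (right_edge (SE S))"
      "\<kappa> (left_edge (NE T)) = \<kappa> (right_edge (NW S))"
      using col by (auto simp: coloring_tangle_sum color_matrix_def)
    then show "fraction (tangle_sum T S) \<kappa> = fraction T (\<kappa> \<circ> left_edge) + fraction S (\<kappa> \<circ> right_edge)"
      by (simp add: fraction_ratio ends_tangle_sum_prod flip: ratio_plus)
  next
    fix T \<kappa>
    assume "diagonal_sum_rule (color_matrix T \<kappa>)" "fraction_defined T \<kappa>"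
    then show "fraction (rotate_ccw T) \<kappa> = - recip (fraction T \<kappa>)"
      by (rule fraction_rotate(2))
  next
    fix T q assume "rational T" "has_fraction T q"
    then obtain w where w: "isotopic T (twist_diagram w)" by (auto simp: rational_def)
    have "q = arith_fraction w"
      by (rule unique[OF \<open>has_fraction T q\<close>]) (use twist[OF w] in \<open>simp add: lawful_def\<close>)
    then show "has_fraction (mirror T) (- q)" using twist[OF w] by (simp add: lawful_def)
  next
    fix T q assume "rational T" "has_fraction T q"
    then obtain w where w: "isotopic T (twist_diagram w)" by (auto simp: rational_def)
    have "q = arith_fraction w"
      by (rule unique[OF \<open>has_fraction T q\<close>]) (use twist[OF w] in \<open>simp add: lawful_def\<close>)
    \<comment> \<open>Mirroring and rotating commute on codes. The mirror image is already known to
      be lawful, so the rotation is applied to it and the two signs cancel.\<close>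
    then have "lawful (rotate_ccw (mirror T)) (- recip (- q))" using twist[OF w] lawful_rotate by blast
    then have "lawful (rotate_ccw (mirror T)) (recip q)"
      by (simp add: recip_uminus uminus_uminus_qinf)
    moreover have "mirror (rotate_ccw T) = rotate_ccw (mirror T)" by (cases T) simp
    ultimately show "has_fraction (mirror (rotate_ccw T)) (recip q)" by (simp add: lawful_def)
  next
    fix T w assume "isotopic T (twist_diagram w)"
    then show "has_fraction T (arith_fraction w)" using twist by (simp add: lawful_def)
  qed
qed

end
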